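(* Let $L>0$ and let $n\ge1$ be an integer. For $a\in L^1(0,L)$ with $\lambda_n\prec a$, consider the following two conditions. (A) $\|a-\lambda_n\|_{L^1(0,L)}<\beta_{1,n}$. (B) There exist points $0=y_0<y_1<\dots<y_{2n+1}<y_{2n+2}=L$ such that for all $0\le i\le 2n+1$, $$y_{i+1}-y_i<\frac{L}{2n}\quad\text{and}\quad \|a-\lambda_n\|_{L^1(y_i,y_{i+1})}<\frac{n\pi}{L}\cot\frac{n\pi(y_{i+1}-y_i)}{L}.$$ Then: (1) If $a\in L^1(0,L)$, $\lambda_n\prec a$, satisfies (B), then the unique solution of $$u''(x)+a(x)u(x)=0,\ x\in(0,L),\qquad u'(0)=u'(L)=0$$ is the trivial one. (2) For $a\in L^1(0,L)$ with $\lambda_n\prec a$, (A) implies (B). (3) If $0=y_0<y_1<\dots<y_{2n+1}<y_{2n+2}=L$ is any distribution of numbers such that $y_{k+1}-y_k<\frac{L}{2n}$ for all $0\le k\le 2n+1$ and $y_{i+1}-y_i\ne y_{j+1}-y_j$ for some $0\le i,j\le 2n+1$, then there exists $a\in L^1(0,L)$ with $\lambda_n\prec a$ which satisfies (B) but does not satisfy (A).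
   Context: For $c,d\in L^1(0,L)$ write $c\prec d$ if $c(x)\le d(x)$ for a.e. $x\in[0,L]$ and $c(x)<d(x)$ on a set of positive measure. $\lambda_n=n^2\pi^2/L^2$, also regarded as a constant function. Solutions of the Neumann problem $u''+au=0$ on $(0,L)$, $u'(0)=u'(L)=0$ are real-valued and taken in the Sobolev space $H^1(0,L)$ in the weak sense; nontrivial means not identically zero. Define $$\Lambda_n=\{a\in L^1(0,L):\ \lambda_n\prec a\ \text{and the Neumann problem has nontrivial solutions}\},\qquad \beta_{1,n}=\inf_{a\in\Lambda_n}\|a-\lambda_n\|_{L^1(0,L)}.$$ *)

theory Defs
  imports "HOL-Analysis.Analysis"
begin

text \<open>Elements of \<open>L\<^sup>1(p,q)\<close>, \<open>L\<^sup>2(p,q)\<close> and \<open>H\<^sup>1(p,q)\<close> are represented by real functions on the whole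
  line; only their values on the open interval matter, and equality of classes is equality almost
  everywhere with respect to Lebesgue measure on that interval.\<close>

definition L1_fun :: "real \<Rightarrow> real \<Rightarrow> (real \<Rightarrow> real) \<Rightarrow> bool" where
  "L1_fun p q f \<longleftrightarrow> integrable (lebesgue_on {p<..<q}) f"

definition L1_norm :: "real \<Rightarrow> real \<Rightarrow> (real \<Rightarrow> real) \<Rightarrow> real" where
  "L1_norm p q f = (\<integral>x. \<bar>f x\<bar> \<partial>lebesgue_on {p<..<q})"

definition L2_fun :: "real \<Rightarrow> real \<Rightarrow> (real \<Rightarrow> real) \<Rightarrow> bool" where
  "L2_fun p q f \<longleftrightarrow> f \<in> borel_measurable (lebesgue_on {p<..<q}) \<and>
     integrable (lebesgue_on {p<..<q}) (\<lambda>x. (f x)\<^sup>2)"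

definition prec :: "real \<Rightarrow> (real \<Rightarrow> real) \<Rightarrow> (real \<Rightarrow> real) \<Rightarrow> bool" where
  "prec L c d \<longleftrightarrow> (AE x in lebesgue_on {0..L}. c x \<le> d x) \<and>
     emeasure lebesgue {x \<in> {0..L}. c x < d x} > 0"

text \<open>Test functions are the \<open>C\<^sup>1\<close> functions with compact support in the open interval.\<close>

definition test_fun :: "real \<Rightarrow> real \<Rightarrow> (real \<Rightarrow> real) \<Rightarrow> bool" where
  "test_fun p q \<phi> \<longleftrightarrow> \<phi> C1_differentiable_on UNIV \<and>
     compact (closure {x. \<phi> x \<noteq> 0}) \<and> closure {x. \<phi> x \<noteq> 0} \<subseteq> {p<..<q}"

text \<open>\<open>H1_deriv p q u v\<close>: \<open>u\<close> belongs to \<open>H\<^sup>1(p,q)\<close> and \<open>v\<close> represents its weak derivative, which is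
  unique up to null sets.\<close>

definition H1_deriv :: "real \<Rightarrow> real \<Rightarrow> (real \<Rightarrow> real) \<Rightarrow> (real \<Rightarrow> real) \<Rightarrow> bool" where
  "H1_deriv p q u v \<longleftrightarrow> L2_fun p q u \<and> L2_fun p q v \<and>
     (\<forall>\<phi>. test_fun p q \<phi> \<longrightarrow>
        (\<integral>x. u x * deriv \<phi> x \<partial>lebesgue_on {p<..<q}) = - (\<integral>x. v x * \<phi> x \<partial>lebesgue_on {p<..<q}))"

text \<open>Weak form of \<open>u'' + a u = 0\<close>, \<open>u'(0) = u'(L) = 0\<close>. The Neumann conditions are natural: they are
  encoded by letting the test functions \<open>w\<close> range over all of \<open>H\<^sup>1(0,L)\<close>. The integral of \<open>a u w\<close> always
  exists for \<open>a \<in> L\<^sup>1\<close>, because \<open>H\<^sup>1\<close> functions in one dimension are essentially bounded.\<close>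

definition neumann_sol :: "real \<Rightarrow> (real \<Rightarrow> real) \<Rightarrow> (real \<Rightarrow> real) \<Rightarrow> bool" where
  "neumann_sol L a u \<longleftrightarrow> (\<exists>u'. H1_deriv 0 L u u' \<and>
     (\<forall>w w'. H1_deriv 0 L w w' \<longrightarrow>
        (\<integral>x. u' x * w' x \<partial>lebesgue_on {0<..<L}) = (\<integral>x. a x * u x * w x \<partial>lebesgue_on {0<..<L})))"

definition trivial_fun :: "real \<Rightarrow> (real \<Rightarrow> real) \<Rightarrow> bool" where
  "trivial_fun L u \<longleftrightarrow> (AE x in lebesgue_on {0<..<L}. u x = 0)"

definition lam :: "real \<Rightarrow> nat \<Rightarrow> real" where
  "lam L n = (real n)\<^sup>2 * pi\<^sup>2 / L\<^sup>2"

definition Lambda_set :: "real \<Rightarrow> nat \<Rightarrow> (real \<Rightarrow> real) set" where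
  "Lambda_set L n = {a. L1_fun 0 L a \<and> prec L (\<lambda>_. lam L n) a \<and>
     (\<exists>u. neumann_sol L a u \<and> \<not> trivial_fun L u)}"

definition beta1 :: "real \<Rightarrow> nat \<Rightarrow> real" where
  "beta1 L n = (INF a\<in>Lambda_set L n. L1_norm 0 L (\<lambda>x. a x - lam L n))"

definition cond_A :: "real \<Rightarrow> nat \<Rightarrow> (real \<Rightarrow> real) \<Rightarrow> bool" where
  "cond_A L n a \<longleftrightarrow> L1_norm 0 L (\<lambda>x. a x - lam L n) < beta1 L n"

definition partition_points :: "real \<Rightarrow> nat \<Rightarrow> (nat \<Rightarrow> real) \<Rightarrow> bool" where
  "partition_points L n y \<longleftrightarrow>
     y 0 = 0 \<and> y (2*n+2) = L \<and> (\<forall>i\<le>2*n+1. y i < y (i+1))"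

definition cond_B_at :: "real \<Rightarrow> nat \<Rightarrow> (nat \<Rightarrow> real) \<Rightarrow> (real \<Rightarrow> real) \<Rightarrow> bool" where
  "cond_B_at L n y a \<longleftrightarrow> (\<forall>i\<le>2*n+1.
     y (i+1) - y i < L / (2 * real n) \<and>
     L1_norm (y i) (y (i+1)) (\<lambda>x. a x - lam L n)
       < real n * pi / L * cot (real n * pi * (y (i+1) - y i) / L))"

definition cond_B :: "real \<Rightarrow> nat \<Rightarrow> (real \<Rightarrow> real) \<Rightarrow> bool" where
  "cond_B L n a \<longleftrightarrow> (\<exists>y. partition_points L n y \<and> cond_B_at L n y a)"

end

theory Submission
  imports Defs
begin

text \<open>Write \<open>\<omega> = n \<pi> / L\<close> and \<open>b = a - \<omega>\<^sup>2\<close>.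

  (1) By Picone's inequality, (B) makes the form \<open>\<integral> V'\<^sup>2 - a V\<^sup>2\<close> positive definite on the functions
  vanishing at the \<open>n + 1\<close> odd partition points. It is nonpositive on the span of a solution \<open>u\<close> and
  of the \<open>n + 1\<close> eigenfunctions \<open>cos (k \<pi> x / L)\<close>, \<open>k \<le> n\<close>. So a nontrivial combination of these
  vanishes identically, and equality in all estimates forces \<open>u = 0\<close>.

  (2) and (3) only need the upper bound \<open>\<beta> \<le> K = (2 n + 2) \<omega> cot (\<omega> L / (2 n + 2))\<close>. It comes from
  potentials equal to \<open>\<omega>\<^sup>2\<close> except for a large constant near the multiples of \<open>L / (n + 1)\<close>.
  If the norm of \<open>b\<close> is below \<open>K\<close>, a greedy choice of the partition succeeds because the cotangent is
  convex. If the partition is unequal, strict convexity leaves room for a piecewise constant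
  \<open>b\<close> of norm exactly \<open>K\<close>.\<close>

section \<open>Absolutely continuous functions\<close>

text \<open>The threshold \<open>\<omega> cot (\<omega> l)\<close> belongs to a piece of length l
  with a zero at one end and a free other end: it is the point mass at the free end for which the
  sine of frequency \<omega> becomes a solution. Every one of the 2 n + 2 pieces has exactly one
  odd-numbered end, so zeros prescribed at the odd points turn all pieces into such mixed problems,
  and (B) keeps each of them below its threshold. K is the sum of the thresholds for equal pieces.
  The ideal extremal potential has its point masses at the free ends; these are not in L^1, so they
  are spread over a width \<eta>, and \<eta> tends to 0 at the end. Two features shape the rest.
  Solutions are weak and \<open>a\<close> is merely integrable, so functions are replaced by
  absolutely continuous representatives and all calculus is done with integrals. Uniqueness compares
  values of a quadratic form, so zeros of solutions are never located or counted.\<close>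

lemma absint_continuous_mult:
  fixes f G :: "real \<Rightarrow> real"
  assumes "f absolutely_integrable_on {p..q}" "continuous_on {p..q} G"
  shows "(\<lambda>x. f x * G x) absolutely_integrable_on {p..q}"
    and "(\<lambda>x. G x * f x) absolutely_integrable_on {p..q}"
proof -
  have m: "G \<in> borel_measurable (lebesgue_on {p..q})"
    by (simp add: assms(2) continuous_imp_measurable_on_sets_lebesgue)
  have b: "bounded (G ` {p..q})"
    using assms(2) compact_continuous_image compact_imp_bounded by blast
  show "(\<lambda>x. G x * f x) absolutely_integrable_on {p..q}"
    by (rule absolutely_integrable_bounded_measurable_product_real[OF m _ b assms(1)]) auto
  then show "(\<lambda>x. f x * G x) absolutely_integrable_on {p..q}"
    by (simp add: mult.commute)
qed

lemma absint_imp_integrable: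
  fixes f :: "real \<Rightarrow> real"
  assumes "f absolutely_integrable_on {p..q}" "p \<le> s" "t \<le> q"
  shows "f integrable_on {s..t}" "(\<lambda>x. \<bar>f x\<bar>) integrable_on {s..t}"
    "f absolutely_integrable_on {s..t}"
proof -
  show *: "f absolutely_integrable_on {s..t}"
    by (rule absolutely_integrable_on_subinterval[OF assms(1)]) (use assms in auto)
  show "f integrable_on {s..t}" "(\<lambda>x. \<bar>f x\<bar>) integrable_on {s..t}"
    using * by (auto simp: absolutely_integrable_on_def)
qed

lemma continuous_imp_absint:
  fixes f :: "real \<Rightarrow> real"
  assumes "continuous_on {p..q} f"
  shows "f absolutely_integrable_on {p..q}"
  using absolutely_integrable_continuous_real[OF assms] .

text \<open>\<open>prim p q F f\<close>: \<open>F\<close> is absolutely continuous on \<open>[p,q]\<close> with derivative \<open>f\<close> almost everywhere.\<close>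

definition prim :: "real \<Rightarrow> real \<Rightarrow> (real \<Rightarrow> real) \<Rightarrow> (real \<Rightarrow> real) \<Rightarrow> bool" where
  "prim p q F f \<longleftrightarrow> f absolutely_integrable_on {p..q} \<and>
     (\<forall>s t. p \<le> s \<and> s \<le> t \<and> t \<le> q \<longrightarrow> (f has_integral (F t - F s)) {s..t})"

lemma primD:
  assumes "prim p q F f" "p \<le> s" "s \<le> t" "t \<le> q"
  shows "(f has_integral (F t - F s)) {s..t}" "integral {s..t} f = F t - F s"
  using assms by (auto simp: prim_def)

lemma prim_absint: "prim p q F f \<Longrightarrow> f absolutely_integrable_on {p..q}"
  by (simp add: prim_def)

lemma prim_integral:
  fixes f :: "real \<Rightarrow> real"
  assumes "f absolutely_integrable_on {p..q}"
  shows "prim p q (\<lambda>x. integral {p..x} f) f"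
  unfolding prim_def
proof (intro conjI allI impI assms, elim conjE)
  fix s t assume st: "p \<le> s" "s \<le> t" "t \<le> q"
  have "integral {p..s} f + integral {s..t} f = integral {p..t} f"
    using st absint_imp_integrable[OF assms]
    by (intro Henstock_Kurzweil_Integration.integral_combine) auto
  then show "(f has_integral integral {p..t} f - integral {p..s} f) {s..t}"
    using absint_imp_integrable(1)[OF assms st(1,3)]
    by (metis add_diff_cancel_left' has_integral_integral)
qed

lemma prim_continuous:
  assumes "prim p q F f"
  shows "continuous_on {p..q} F"
proof -
  have "continuous_on {p..q} (\<lambda>x. F p + integral {p..x} f)"
    using absint_imp_integrable(1)[OF prim_absint[OF assms] order_refl order_refl]
    by (intro continuous_intros indefinite_integral_continuous_1)
  then show ?thesis
    by (rule continuous_on_eq) (use primD(2)[OF assms order_refl] in auto)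
qed

lemma prim_subinterval:
  assumes "prim p q F f" "p \<le> s" "t \<le> q"
  shows "prim s t F f"
  using assms absint_imp_integrable(3)[OF prim_absint[OF assms(1)] assms(2,3)] by (auto simp: prim_def)

lemma prim_add: "prim p q F f \<Longrightarrow> prim p q G g \<Longrightarrow> prim p q (\<lambda>x. F x + G x) (\<lambda>x. f x + g x)"
  unfolding prim_def by (auto simp: add_diff_add intro!: has_integral_add)

lemma prim_cmul: "prim p q F f \<Longrightarrow> prim p q (\<lambda>x. c * F x) (\<lambda>x. c * f x)"
  unfolding prim_def by (auto simp: right_diff_distrib[symmetric] intro!: has_integral_mult_right)

lemma prim_const: "prim p q (\<lambda>x. c) (\<lambda>x. 0)"
  unfolding prim_def by auto

lemma prim_sum:
  assumes "finite I" "\<And>i. i \<in> I \<Longrightarrow> prim p q (F i) (f i)"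
  shows "prim p q (\<lambda>x. \<Sum>i\<in>I. F i x) (\<lambda>x. \<Sum>i\<in>I. f i x)"
  using assms by (induction I rule: finite_induct) (auto intro: prim_add prim_const)

text \<open>The exceptional set is there for the near-extremal potentials, which jump at finitely
  many points of an interval and are composed with a triangle wave that has corners.\<close>

lemma prim_deriv_except_finite:
  assumes "finite S" "continuous_on {p..q} F"
    and "\<And>x. x \<in> {p<..<q} - S \<Longrightarrow> (F has_real_derivative f x) (at x)"
    and "f absolutely_integrable_on {p..q}"
  shows "prim p q F f"
  unfolding prim_def
proof (intro conjI allI impI assms(4), elim conjE)
  fix s t assume "p \<le> s" "s \<le> t" "t \<le> q"
  then show "(f has_integral F t - F s) {s..t}"
    using assms
    by (intro fundamental_theorem_of_calculus_interior_strong[OF assms(1)])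
       (auto simp: has_real_derivative_iff_has_vector_derivative elim: continuous_on_subset)
qed

lemma prim_C1:
  assumes "continuous_on {p..q} f"
    and "\<And>x. x \<in> {p..q} \<Longrightarrow> (F has_real_derivative f x) (at x)"
  shows "prim p q F f"
proof (rule prim_deriv_except_finite[of "{}"])
  show "continuous_on {p..q} F"
    using assms(2) by (meson DERIV_atLeastAtMost_imp_continuous_on atLeastAtMost_iff)
qed (use assms continuous_imp_absint in auto)

text \<open>For absolutely continuous functions the increment of the product differs from the integral
  over \<open>[s,t]\<close> by a small multiple of \<open>\<integral> \<bar>f\<bar> + \<bar>g\<bar>\<close> when \<open>t - s\<close> is small; this estimate is additive
  in the interval, hence global by bisection.\<close>

lemma prim_mult:
  assumes F: "prim p q F f" and G: "prim p q G g"
  shows "prim p q (\<lambda>x. F x * G x) (\<lambda>x. f x * G x + F x * g x)"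
proof -
  define h where "h \<equiv> \<lambda>x. f x * G x + F x * g x"
  define m where "m \<equiv> \<lambda>x. \<bar>f x\<bar> + \<bar>g x\<bar>"
  note af = prim_absint[OF F] and ag = prim_absint[OF G]
  note cF = prim_continuous[OF F] and cG = prim_continuous[OF G]
  have ah: "h absolutely_integrable_on {p..q}"
    unfolding h_def using absint_continuous_mult[OF af cG] absint_continuous_mult[OF ag cF] by auto
  have am: "m absolutely_integrable_on {p..q}"
    unfolding m_def using af ag by (intro set_integral_add(1) set_integrable_abs)
  note ih = absint_imp_integrable(1)[OF ah] and im = absint_imp_integrable(1)[OF am]
  have "(h has_integral F t0 * G t0 - F s0 * G s0) {s0..t0}"
    if st0: "p \<le> s0" "s0 \<le> t0" "t0 \<le> q" for s0 t0
  proof -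
    define D where "D \<equiv> \<lambda>s t. F t * G t - F s * G s - integral {s..t} h"
    have *: "\<bar>D s0 t0\<bar> \<le> e * integral {s0..t0} m" if e: "e > 0" for e
    proof -
      have "s0 \<le> s0 \<longrightarrow> t0 \<le> t0 \<longrightarrow> \<bar>D s0 t0\<bar> \<le> e * integral {s0..t0} m"
        using st0(2)
      \<comment> \<open>The local case meets small intervals around x that may stick out of [s0,t0];
        hence the two bounds are premises inside the predicate.\<close>
      proof (induction s0 t0 rule: Bolzano[where P = "\<lambda>s t. s0 \<le> s \<longrightarrow> t \<le> t0 \<longrightarrow> \<bar>D s t\<bar> \<le> e * integral {s..t} m"])
        case (trans a b c)
        show ?case
        proof (intro impI)
          assume ac: "s0 \<le> a" "c \<le> t0"
          have "integral {a..b} m + integral {b..c} m = integral {a..c} m"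
            "integral {a..b} h + integral {b..c} h = integral {a..c} h"
            using trans ac st0 by (auto intro!: Henstock_Kurzweil_Integration.integral_combine ih im)
          moreover have "\<bar>D a b\<bar> \<le> e * integral {a..b} m" "\<bar>D b c\<bar> \<le> e * integral {b..c} m"
            using trans ac by auto
          ultimately have "\<bar>D a c\<bar> \<le> e * integral {a..b} m + e * integral {b..c} m"
            unfolding D_def by linarith
          then show "\<bar>D a c\<bar> \<le> e * integral {a..c} m"
            using \<open>integral {a..b} m + integral {b..c} m = _\<close> by (metis distrib_left)
        qed
      next
        case (local x)
        then have x: "x \<in> {p..q}" using st0 by auto
        obtain d1 where d1: "d1 > 0" "\<And>r. r \<in> {p..q} \<Longrightarrow> \<bar>r - x\<bar> < d1 \<Longrightarrow> \<bar>F r - F x\<bar> < e/2"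
          using cF x e unfolding continuous_on_iff dist_real_def by (meson half_gt_zero)
        obtain d2 where d2: "d2 > 0" "\<And>r. r \<in> {p..q} \<Longrightarrow> \<bar>r - x\<bar> < d2 \<Longrightarrow> \<bar>G r - G x\<bar> < e/2"
          using cG x e unfolding continuous_on_iff dist_real_def by (meson half_gt_zero)
        show ?case
        proof (intro exI[of _ "min d1 d2"] conjI allI impI)
          show "min d1 d2 > 0" using d1 d2 by auto
          fix s t assume A: "s \<le> x \<and> x \<le> t \<and> t - s < min d1 d2" "s0 \<le> s" "t \<le> t0"
          then have st: "p \<le> s" "s \<le> t" "t \<le> q" using st0 by auto
          \<comment> \<open>Splitting F t G t - F s G s as F t (G t - G s) + G s (F t - F s) turns
            \<open>D s t\<close> into an integral of the oscillations of F and G against g and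
            f.\<close>
          have "((\<lambda>r. F t * g r + G s * f r) has_integral F t * (G t - G s) + G s * (F t - F s)) {s..t}"
            using primD(1)[OF F st] primD(1)[OF G st]
            by (intro has_integral_add has_integral_mult_right)
          then have "((\<lambda>r. F t * g r + G s * f r - h r) has_integral
              (F t * (G t - G s) + G s * (F t - F s) - integral {s..t} h)) {s..t}"
            using ih st by (intro has_integral_diff) (auto simp: has_integral_integral)
          then have D: "((\<lambda>r. (F t - F r) * g r + (G s - G r) * f r) has_integral D s t) {s..t}"
            unfolding D_def h_def by (simp add: algebra_simps)
          have "\<bar>(F t - F r) * g r + (G s - G r) * f r\<bar> \<le> e * m r" if r: "r \<in> {s..t}" for r
          proof -
            have "\<bar>F t - F x\<bar> < e/2" "\<bar>F r - F x\<bar> < e/2" "\<bar>G s - G x\<bar> < e/2" "\<bar>G r - G x\<bar> < e/2"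
              using A st r d1(2)[of t] d1(2)[of r] d2(2)[of s] d2(2)[of r] by auto
            then have "\<bar>F t - F r\<bar> \<le> e" "\<bar>G s - G r\<bar> \<le> e" by linarith+
            then have "\<bar>(F t - F r) * g r\<bar> \<le> e * \<bar>g r\<bar>" "\<bar>(G s - G r) * f r\<bar> \<le> e * \<bar>f r\<bar>"
              by (auto simp: abs_mult intro: mult_right_mono)
            then show ?thesis unfolding m_def distrib_left by linarith
          qed
          then have "norm (integral {s..t} (\<lambda>r. (F t - F r) * g r + (G s - G r) * f r)) \<le> integral {s..t} (\<lambda>r. e * m r)"
            using D im st by (intro Henstock_Kurzweil_Integration.integral_norm_bound_integral integrable_on_mult_right)
               (auto simp: has_integral_integrable)
          then show "\<bar>D s t\<bar> \<le> e * integral {s..t} m"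
            using D by (simp add: integral_unique)
        qed
      qed
      then show ?thesis by simp
    qed
    have "\<bar>D s0 t0\<bar> \<le> 0"
    proof (rule field_le_epsilon)
      fix e :: real assume e: "e > 0"
      have M: "integral {s0..t0} m \<ge> 0"
        by (rule Henstock_Kurzweil_Integration.integral_nonneg) (use im st0 in \<open>auto simp: m_def\<close>)
      have "\<bar>D s0 t0\<bar> \<le> e / (integral {s0..t0} m + 1) * integral {s0..t0} m"
        using M e by (intro *) auto
      also have "\<dots> \<le> e"
        using M e by (simp add: field_simps)
      finally show "\<bar>D s0 t0\<bar> \<le> 0 + e" by simp
    qed
    then show ?thesis
      using ih st0 unfolding D_def by (simp add: has_integral_integrable_integral)
  qed
  with ah show ?thesis unfolding prim_def h_def by blast
qed

section \<open>Picone's inequality\<close>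

lemma prim_sq:
  assumes "prim p q F f"
  shows "prim p q (\<lambda>x. (F x)\<^sup>2) (\<lambda>x. 2 * (F x * f x))"
  using prim_mult[OF assms assms] by (simp add: power2_eq_square algebra_simps)

text \<open>The Riccati equation says that g is the logarithmic derivative of a solution of w'' +
  \<open>\<omega>\<^sup>2\<close> w = 0. The integrand minus the derivative of
  \<open>(V x)\<^sup>2 * g x\<close> is then the square of v - g V.\<close>

lemma picone:
  fixes \<omega> :: real
  assumes V: "prim p q V v" and v2: "(\<lambda>x. (v x)\<^sup>2) absolutely_integrable_on {p..q}" and "p \<le> q"
    and g: "\<And>x. x \<in> {p..q} \<Longrightarrow> (g has_real_derivative - (\<omega>\<^sup>2 + (g x)\<^sup>2)) (at x)"
  shows "(V q)\<^sup>2 * g q - (V p)\<^sup>2 * g p \<le> integral {p..q} (\<lambda>x. (v x)\<^sup>2 - \<omega>\<^sup>2 * (V x)\<^sup>2)"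
proof -
  have cg: "continuous_on {p..q} g"
    using g by (meson DERIV_atLeastAtMost_imp_continuous_on atLeastAtMost_iff)
  note cV = prim_continuous[OF V]
  have G: "prim p q g (\<lambda>x. - (\<omega>\<^sup>2 + (g x)\<^sup>2))"
    by (rule prim_C1) (use g cg in \<open>auto intro!: continuous_intros\<close>)
  note P = primD[OF prim_mult[OF prim_sq[OF V] G] order_refl \<open>p \<le> q\<close> order_refl]
  have "(\<lambda>x. (v x)\<^sup>2 - \<omega>\<^sup>2 * (V x)\<^sup>2) absolutely_integrable_on {p..q}"
    using cV by (intro set_integral_diff(1) v2 continuous_imp_absint continuous_intros)
  moreover have "2 * (V x * v x) * g x + (V x)\<^sup>2 * - (\<omega>\<^sup>2 + (g x)\<^sup>2) \<le> (v x)\<^sup>2 - \<omega>\<^sup>2 * (V x)\<^sup>2" for x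
    using zero_le_power2[of "v x - g x * V x"] by (simp add: power2_eq_square algebra_simps)
  ultimately show ?thesis
    unfolding P(2)[symmetric] using P(1)
    by (intro integral_le) (auto simp: absolutely_integrable_on_def has_integral_integrable)
qed

text \<open>Two Riccati functions meet at z. The terms at p and q vanish, because V or the Riccati
  function does, and only the jump at z survives.\<close>

lemma picone_interior:
  fixes \<omega> :: real
  assumes V: "prim p q V v" and v2: "(\<lambda>x. (v x)\<^sup>2) absolutely_integrable_on {p..q}" and z: "z \<in> {p..q}"
    and g1: "\<And>x. x \<in> {p..z} \<Longrightarrow> (g1 has_real_derivative - (\<omega>\<^sup>2 + (g1 x)\<^sup>2)) (at x)"
    and g2: "\<And>x. x \<in> {z..q} \<Longrightarrow> (g2 has_real_derivative - (\<omega>\<^sup>2 + (g2 x)\<^sup>2)) (at x)"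
    and "(V p)\<^sup>2 * g1 p = 0" "(V q)\<^sup>2 * g2 q = 0"
  shows "(V z)\<^sup>2 * (g1 z - g2 z) \<le> integral {p..q} (\<lambda>x. (v x)\<^sup>2 - \<omega>\<^sup>2 * (V x)\<^sup>2)"
proof -
  have "(\<lambda>x. (v x)\<^sup>2 - \<omega>\<^sup>2 * (V x)\<^sup>2) absolutely_integrable_on {p..q}"
    using prim_continuous[OF V] by (intro set_integral_diff(1) v2 continuous_imp_absint continuous_intros)
  then have "integral {p..z} (\<lambda>x. (v x)\<^sup>2 - \<omega>\<^sup>2 * (V x)\<^sup>2) + integral {z..q} (\<lambda>x. (v x)\<^sup>2 - \<omega>\<^sup>2 * (V x)\<^sup>2)
      = integral {p..q} (\<lambda>x. (v x)\<^sup>2 - \<omega>\<^sup>2 * (V x)\<^sup>2)"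
    using z by (intro Henstock_Kurzweil_Integration.integral_combine) (auto simp: absolutely_integrable_on_def)
  moreover have "(V z)\<^sup>2 * g1 z - (V p)\<^sup>2 * g1 p \<le> integral {p..z} (\<lambda>x. (v x)\<^sup>2 - \<omega>\<^sup>2 * (V x)\<^sup>2)"
    using z by (intro picone g1 prim_subinterval[OF V] absint_imp_integrable(3)[OF v2]) auto
  moreover have "(V q)\<^sup>2 * g2 q - (V z)\<^sup>2 * g2 z \<le> integral {z..q} (\<lambda>x. (v x)\<^sup>2 - \<omega>\<^sup>2 * (V x)\<^sup>2)"
    using z by (intro picone g2 prim_subinterval[OF V] absint_imp_integrable(3)[OF v2]) auto
  ultimately show ?thesis
    using assms(6,7) unfolding right_diff_distrib by linarith
qed

text \<open>The difference on the right is cos (A + B) / (sin A cos B), and this denominator is at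
  most sin (A + B). With A the distance from the zero to the maximum and B the rest of the piece,
  this says that a maximum at the free end (B = 0) is the worst case.\<close>

lemma cot_minus_tan_ge:
  fixes A B :: real
  assumes "A > 0" "B \<ge> 0" "A + B < pi/2"
  shows "cot (A + B) \<le> cot A - tan B"
proof -
  have p: "sin A > 0" "cos B > 0" "cos A > 0" "sin B \<ge> 0" "sin (A+B) > 0" "cos (A+B) \<ge> 0"
    using assms pi_gt_zero by (auto intro!: sin_gt_zero cos_gt_zero_pi sin_ge_zero less_imp_le[OF cos_gt_zero_pi])
  have "cot A - tan B = cos (A+B) / (sin A * cos B)"
    using p by (simp add: cot_def tan_def cos_add field_simps)
  moreover have "sin A * cos B \<le> sin (A+B)"
    using p by (simp add: sin_add)
  ultimately show ?thesis
    using p by (simp add: cot_def divide_left_mono)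
qed

lemma cot_less_perturb:
  fixes \<omega> l c :: real
  assumes "\<omega> > 0" "l > 0" "\<omega> * l < pi/2" "c < \<omega> * cot (\<omega> * l)"
  obtains d where "d > 0" "\<omega> * (l + d) < pi/2" "c < \<omega> * cot (\<omega> * (l + d))"
proof -
  have "sin (\<omega> * l) \<noteq> 0"
    using assms pi_gt_zero by (intro less_imp_neq[symmetric] sin_gt_zero mult_pos_pos) linarith+
  then have "((\<lambda>d. \<omega> * cot (\<omega> * (l + d))) \<longlongrightarrow> \<omega> * cot (\<omega> * (l + 0))) (at_right 0)"
    by (intro tendsto_intros) auto
  then have "eventually (\<lambda>d. c < \<omega> * cot (\<omega> * (l + d))) (at_right 0)"
    by (rule order_tendstoD(1)) (use assms in simp)
  moreover have "((\<lambda>d. \<omega> * (l + d)) \<longlongrightarrow> \<omega> * (l + 0)) (at_right 0)"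
    by (intro tendsto_intros)
  then have "eventually (\<lambda>d. \<omega> * (l + d) < pi/2) (at_right 0)"
    by (rule order_tendstoD(2)) (use assms in simp)
  moreover have "eventually (\<lambda>d::real. d > 0) (at_right 0)"
    by (simp add: eventually_at_right_less)
  ultimately have "eventually (\<lambda>d. d > 0 \<and> \<omega> * (l + d) < pi/2 \<and> c < \<omega> * cot (\<omega> * (l + d))) (at_right 0)"
    by eventually_elim auto
  then show ?thesis
    using that eventually_happens'[OF trivial_limit_at_right_real] by blast
qed

text \<open>If \<open>\<bar>V\<bar>\<close> is maximal at \<open>z\<close> then \<open>\<integral> b V\<^sup>2 \<le> (V z)\<^sup>2 \<integral> b\<close>, while Picone's inequality with a
  cotangent on the side of \<open>z\<close> where \<open>V\<close> vanishes at the end, and a tangent on the other side,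
  bounds the remaining part below. The shift \<open>d\<close> keeps the cotangent finite at the end point.\<close>

lemma mixed_form_pos:
  fixes \<omega> :: real
  assumes V: "prim p q V v" and v2: "(\<lambda>x. (v x)\<^sup>2) absolutely_integrable_on {p..q}"
    and b: "b absolutely_integrable_on {p..q}" "\<And>x. x \<in> {p..q} \<Longrightarrow> b x \<ge> 0"
    and \<omega>: "\<omega> > 0" "p < q" "\<omega> * (q - p) < pi/2" "integral {p..q} b < \<omega> * cot (\<omega> * (q - p))"
    and V0: "V p = 0 \<or> V q = 0" and x1: "x1 \<in> {p..q}" "V x1 \<noteq> 0"
  shows "0 < integral {p..q} (\<lambda>x. (v x)\<^sup>2 - (\<omega>\<^sup>2 + b x) * (V x)\<^sup>2)"
proof -
  note cV = prim_continuous[OF V]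
  obtain z where z: "z \<in> {p..q}" and zm: "\<And>x. x \<in> {p..q} \<Longrightarrow> (V x)\<^sup>2 \<le> (V z)\<^sup>2"
    using continuous_attains_sup[of "{p..q}" "\<lambda>x. (V x)\<^sup>2"] continuous_on_power[OF cV] \<open>p < q\<close>
    by auto
  have Vz: "(V z)\<^sup>2 > 0"
    using zm[OF x1(1)] x1(2) by (smt (verit) zero_less_power2)
  obtain d where d: "d > 0" "\<omega> * (q - p + d) < pi/2" "integral {p..q} b < \<omega> * cot (\<omega> * (q - p + d))"
    using cot_less_perturb[OF \<omega>(1) _ \<omega>(3,4)] \<omega>(2) by auto
  have small: "\<omega> * r < pi/2" if "r \<le> q - p + d" for r
    using that \<omega>(1) d(2) by (smt (verit) mult_left_mono)
  have tan': "((\<lambda>x. \<omega> * tan (\<omega> * (q - x))) has_real_derivative - (\<omega>\<^sup>2 + (\<omega> * tan (\<omega> * (q - x)))\<^sup>2)) (at x)"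
    "((\<lambda>x. - (\<omega> * tan (\<omega> * (x - p)))) has_real_derivative - (\<omega>\<^sup>2 + (- (\<omega> * tan (\<omega> * (x - p))))\<^sup>2)) (at x)"
    if "x \<in> {p..q}" for x
  proof -
    have "cos (\<omega> * (q - x)) \<noteq> 0" "cos (\<omega> * (x - p)) \<noteq> 0"
      using that \<omega>(1) d(1) small[of "q - x"] small[of "x - p"]
      by (auto intro!: less_imp_neq[symmetric] cos_gt_zero_pi) (smt (verit) mult_nonneg_nonneg pi_half_gt_zero)+
    then show "((\<lambda>x. \<omega> * tan (\<omega> * (q - x))) has_real_derivative - (\<omega>\<^sup>2 + (\<omega> * tan (\<omega> * (q - x)))\<^sup>2)) (at x)"
      "((\<lambda>x. - (\<omega> * tan (\<omega> * (x - p)))) has_real_derivative - (\<omega>\<^sup>2 + (- (\<omega> * tan (\<omega> * (x - p))))\<^sup>2)) (at x)"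
      by (auto intro!: derivative_eq_intros simp: power_inverse[symmetric] tan_sec[symmetric])
         (simp_all add: algebra_simps power2_eq_square)
  qed
  have cot': "((\<lambda>x. \<omega> * cot (\<omega> * (x - p + d))) has_real_derivative - (\<omega>\<^sup>2 + (\<omega> * cot (\<omega> * (x - p + d)))\<^sup>2)) (at x)"
    "((\<lambda>x. - (\<omega> * cot (\<omega> * (q + d - x)))) has_real_derivative - (\<omega>\<^sup>2 + (- (\<omega> * cot (\<omega> * (q + d - x))))\<^sup>2)) (at x)"
    if "x \<in> {p..q}" for x
  proof -
    have "sin (\<omega> * (x - p + d)) \<noteq> 0" "sin (\<omega> * (q + d - x)) \<noteq> 0"
      using that \<omega>(1) d(1) small[of "x - p + d"] small[of "q + d - x"] pi_gt_zero
      by (auto simp del: pi_gt_zero intro!: less_imp_neq[symmetric] sin_gt_zero mult_pos_pos) (linarith+)?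
    then show "((\<lambda>x. \<omega> * cot (\<omega> * (x - p + d))) has_real_derivative - (\<omega>\<^sup>2 + (\<omega> * cot (\<omega> * (x - p + d)))\<^sup>2)) (at x)"
     "((\<lambda>x. - (\<omega> * cot (\<omega> * (q + d - x)))) has_real_derivative - (\<omega>\<^sup>2 + (- (\<omega> * cot (\<omega> * (q + d - x))))\<^sup>2)) (at x)"
      by (auto intro!: derivative_eq_intros simp: power2_eq_square field_simps cot_def)
  qed
  have *: "(V z)\<^sup>2 * (\<omega> * cot (\<omega> * (q - p + d))) \<le> integral {p..q} (\<lambda>x. (v x)\<^sup>2 - \<omega>\<^sup>2 * (V x)\<^sup>2)"
    using V0
  proof
    assume "V p = 0"
    \<comment> \<open>No boundary term remains: at q the tangent is zero, at p the factor V p is.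
      The other case is the mirror image.\<close>
    have "(V z)\<^sup>2 * (\<omega> * cot (\<omega> * (z - p + d)) - \<omega> * tan (\<omega> * (q - z)))
       \<le> integral {p..q} (\<lambda>x. (v x)\<^sup>2 - \<omega>\<^sup>2 * (V x)\<^sup>2)"
      using z \<open>V p = 0\<close> by (intro picone_interior[OF V v2 z] tan' cot') auto
    note P = this
    have "cot (\<omega> * (z - p + d) + \<omega> * (q - z)) \<le> cot (\<omega> * (z - p + d)) - tan (\<omega> * (q - z))"
    proof (rule cot_minus_tan_ge)
      show "\<omega> * (z - p + d) + \<omega> * (q - z) < pi / 2"
        using d(2) by (simp add: algebra_simps)
    qed (use z d \<omega> in auto)
    moreover have "\<omega> * (z - p + d) + \<omega> * (q - z) = \<omega> * (q - p + d)"
      by (simp add: algebra_simps)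
    ultimately have "\<omega> * cot (\<omega> * (q - p + d)) \<le> \<omega> * (cot (\<omega> * (z - p + d)) - tan (\<omega> * (q - z)))"
      using \<omega>(1) by simp
    then have "(V z)\<^sup>2 * (\<omega> * cot (\<omega> * (q - p + d))) \<le> (V z)\<^sup>2 * (\<omega> * (cot (\<omega> * (z - p + d)) - tan (\<omega> * (q - z))))"
      by (rule mult_left_mono) auto
    with P show ?thesis by (simp add: right_diff_distrib)
  next
    assume "V q = 0"
    have "(V z)\<^sup>2 * (- (\<omega> * tan (\<omega> * (z - p))) - - (\<omega> * cot (\<omega> * (q + d - z))))
       \<le> integral {p..q} (\<lambda>x. (v x)\<^sup>2 - \<omega>\<^sup>2 * (V x)\<^sup>2)"
      using z \<open>V q = 0\<close>
      by (intro picone_interior[OF V v2 z, where ?g1.0 = "\<lambda>x. - (\<omega> * tan (\<omega> * (x - p)))" and ?g2.0 = "\<lambda>x. - (\<omega> * cot (\<omega> * (q + d - x)))"] tan' cot') auto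
    note P = this
    have "cot (\<omega> * (q + d - z) + \<omega> * (z - p)) \<le> cot (\<omega> * (q + d - z)) - tan (\<omega> * (z - p))"
    proof (rule cot_minus_tan_ge)
      show "\<omega> * (q + d - z) + \<omega> * (z - p) < pi / 2"
        using d(2) by (simp add: algebra_simps)
    qed (use z d \<omega> in auto)
    moreover have "\<omega> * (q + d - z) + \<omega> * (z - p) = \<omega> * (q - p + d)"
      by (simp add: algebra_simps)
    ultimately have "\<omega> * cot (\<omega> * (q - p + d)) \<le> \<omega> * (cot (\<omega> * (q + d - z)) - tan (\<omega> * (z - p)))"
      using \<omega>(1) by simp
    then have "(V z)\<^sup>2 * (\<omega> * cot (\<omega> * (q - p + d))) \<le> (V z)\<^sup>2 * (\<omega> * (cot (\<omega> * (q + d - z)) - tan (\<omega> * (z - p))))"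
      by (rule mult_left_mono) auto
    with P show ?thesis by (simp add: right_diff_distrib)
  qed
  have c: "continuous_on {p..q} (\<lambda>x. (V x)\<^sup>2)" "continuous_on {p..q} (\<lambda>x. \<omega>\<^sup>2 * (V x)\<^sup>2)"
    by (auto intro!: continuous_intros cV)
  have i1: "(\<lambda>x. (v x)\<^sup>2 - \<omega>\<^sup>2 * (V x)\<^sup>2) integrable_on {p..q}"
    using set_integral_diff(1)[OF v2 continuous_imp_absint[OF c(2)]]
    by (simp add: absolutely_integrable_on_def)
  have i2: "(\<lambda>x. b x * (V x)\<^sup>2) integrable_on {p..q}"
    using absint_continuous_mult(1)[OF b(1) c(1)] by (simp add: absolutely_integrable_on_def)
  have i3: "b integrable_on {p..q}" using b(1) by (simp add: absolutely_integrable_on_def)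
  have "integral {p..q} (\<lambda>x. b x * (V x)\<^sup>2) \<le> integral {p..q} (\<lambda>x. b x * (V z)\<^sup>2)"
    using i2 i3 b(2) zm by (intro integral_le integrable_on_mult_left) (auto intro!: mult_left_mono)
  also have "\<dots> = integral {p..q} b * (V z)\<^sup>2" by simp
  also have "\<dots> < \<omega> * cot (\<omega> * (q - p + d)) * (V z)\<^sup>2"
    using d(3) Vz by simp
  finally have "0 < integral {p..q} (\<lambda>x. (v x)\<^sup>2 - \<omega>\<^sup>2 * (V x)\<^sup>2) - integral {p..q} (\<lambda>x. b x * (V x)\<^sup>2)"
    using * by (simp add: mult.commute)
  also have "\<dots> = integral {p..q} (\<lambda>x. ((v x)\<^sup>2 - \<omega>\<^sup>2 * (V x)\<^sup>2) - b x * (V x)\<^sup>2)"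
    by (rule Henstock_Kurzweil_Integration.integral_diff[symmetric]) (rule i1 i2)+
  finally show ?thesis by (simp add: algebra_simps)
qed

text \<open>Gaussian elimination: a pivot \<open>A i k\<close> removes the unknown k from the
  remaining equations, and \<open>c'\<close> recovers it by back substitution. It will produce a
  combination of n + 2 functions with zeros at n + 1 given points.\<close>

lemma homogeneous_system_nontrivial:
  fixes A :: "'i \<Rightarrow> 'j \<Rightarrow> real"
  assumes "finite I" "finite J" "card I < card J"
  shows "\<exists>c. (\<exists>j\<in>J. c j \<noteq> 0) \<and> (\<forall>i\<in>I. (\<Sum>j\<in>J. c j * A i j) = 0)"
  using assms
proof (induction I arbitrary: J A rule: finite_induct)
  case empty
  then obtain j where "j \<in> J" by (metis card_gt_0_iff card.empty ex_in_conv)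
  then show ?case by (intro exI[of _ "\<lambda>_. 1"]) auto
next
  case (insert i I)
  show ?case
  proof (cases "\<forall>j\<in>J. A i j = 0")
    case True
    obtain c where "\<exists>j\<in>J. c j \<noteq> 0" "\<forall>i\<in>I. (\<Sum>j\<in>J. c j * A i j) = 0"
      using insert.IH[of J A] insert.prems insert.hyps by auto
    then show ?thesis using True by (intro exI[of _ c]) auto
  next
    case False
    then obtain k where k: "k \<in> J" "A i k \<noteq> 0" by auto
    define J' where "J' = J - {k}"
    have J: "J = insert k J'" "k \<notin> J'" "finite J'" using k insert.prems by (auto simp: J'_def)
    obtain c where c: "\<exists>j\<in>J'. c j \<noteq> 0"
      "\<forall>h\<in>I. (\<Sum>j\<in>J'. c j * (A h j - A h k * A i j / A i k)) = 0"
      using insert.IH[of J' "\<lambda>h j. A h j - A h k * A i j / A i k"] insert.prems insert.hyps J by auto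
    define c' where "c' = c(k := - (\<Sum>j\<in>J'. c j * A i j) / A i k)"
    have S: "(\<Sum>j\<in>J. c' j * A h j) = (\<Sum>j\<in>J'. c j * A h j) - (\<Sum>j\<in>J'. c j * A i j) / A i k * A h k" for h
    proof -
      have "(\<Sum>j\<in>J'. c' j * A h j) = (\<Sum>j\<in>J'. c j * A h j)"
        using J(2) by (intro sum.cong) (auto simp: c'_def)
      then show ?thesis using J by (simp add: c'_def)
    qed
    have "(\<Sum>j\<in>J. c' j * A h j) = 0" if "h \<in> I" for h
    proof -
      have "0 = (\<Sum>j\<in>J'. c j * A h j - c j * A i j * (A h k / A i k))"
        using c(2) that by (simp add: algebra_simps)
      also have "\<dots> = (\<Sum>j\<in>J. c' j * A h j)"
        unfolding S sum_subtractf sum_distrib_right[symmetric] by simp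
      finally show ?thesis by simp
    qed
    moreover have "(\<Sum>j\<in>J. c' j * A i j) = 0"
      unfolding S using k by simp
    moreover have "\<exists>j\<in>J. c' j \<noteq> 0"
      using c(1) J by (auto simp: c'_def)
    ultimately show ?thesis by blast
  qed
qed

section \<open>Sobolev functions on an interval\<close>

text \<open>The endpoints are null, so the open intervals of the definitions can be exchanged for
  closed ones, on which all estimates are made with gauge integrals.\<close>

lemma L1_fun_iff: "L1_fun p q f \<longleftrightarrow> f absolutely_integrable_on {p..q}"
  unfolding L1_fun_def absolutely_integrable_on_Icc_iff_Ioo
  by (auto simp: integrable_restrict_space set_integrable_def)

lemma lebesgue_on_Ioo_integral:
  fixes f :: "real \<Rightarrow> real"
  assumes "f absolutely_integrable_on {p..q}"
  shows "(\<integral>x. f x \<partial>lebesgue_on {p<..<q}) = integral {p..q} f"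
  using assms L1_fun_iff[of p q f] lebesgue_integral_eq_integral[of "{p<..<q}" f]
  by (simp add: L1_fun_def integral_open_interval_real)

lemma L1_norm_eq:
  assumes "f absolutely_integrable_on {p..q}"
  shows "L1_norm p q f = integral {p..q} (\<lambda>x. \<bar>f x\<bar>)"
  unfolding L1_norm_def by (rule lebesgue_on_Ioo_integral) (use assms in \<open>simp add: set_integrable_abs\<close>)

lemma L2_fun_iff:
  "L2_fun p q f \<longleftrightarrow> f absolutely_integrable_on {p..q} \<and> (\<lambda>x. (f x)\<^sup>2) absolutely_integrable_on {p..q}"
proof
  assume *: "L2_fun p q f"
  then have f2: "(\<lambda>x. (f x)\<^sup>2) absolutely_integrable_on {p..q}"
    using L1_fun_iff[of p q "\<lambda>x. (f x)\<^sup>2"] by (simp add: L2_fun_def L1_fun_def)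
  then have "(\<lambda>x. 1 + (f x)\<^sup>2) integrable_on {p<..<q}"
    unfolding absolutely_integrable_on_def
    by (simp flip: integrable_on_Icc_iff_Ioo) (intro integrable_add; auto)
  moreover have "\<bar>y\<bar> \<le> 1 + y\<^sup>2" for y :: real
    using zero_le_power2[of "\<bar>y\<bar> - 1"] zero_le_power2[of y] by (simp add: power2_diff)
  ultimately have "f absolutely_integrable_on {p<..<q}"
    using * by (intro measurable_bounded_by_integrable_imp_absolutely_integrable[where g = "\<lambda>x. 1 + (f x)\<^sup>2"])
      (auto simp: L2_fun_def)
  with f2 show "f absolutely_integrable_on {p..q} \<and> (\<lambda>x. (f x)\<^sup>2) absolutely_integrable_on {p..q}"
    by (simp add: absolutely_integrable_on_Icc_iff_Ioo)
next
  assume *: "f absolutely_integrable_on {p..q} \<and> (\<lambda>x. (f x)\<^sup>2) absolutely_integrable_on {p..q}"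
  then have "f \<in> borel_measurable (lebesgue_on {p<..<q})"
    by (intro absolutely_integrable_imp_borel_measurable) (auto simp: absolutely_integrable_on_Icc_iff_Ioo)
  then show "L2_fun p q f"
    using * L1_fun_iff[of p q "\<lambda>x. (f x)\<^sup>2"] by (simp add: L2_fun_def L1_fun_def)
qed

lemma absint_mult_of_squares:
  fixes f g :: "real \<Rightarrow> real"
  assumes "f absolutely_integrable_on {p..q}" "(\<lambda>x. (f x)\<^sup>2) absolutely_integrable_on {p..q}"
    and "g absolutely_integrable_on {p..q}" "(\<lambda>x. (g x)\<^sup>2) absolutely_integrable_on {p..q}"
  shows "(\<lambda>x. f x * g x) absolutely_integrable_on {p..q}"
proof (rule measurable_bounded_by_integrable_imp_absolutely_integrable[where g = "\<lambda>x. (f x)\<^sup>2 + (g x)\<^sup>2"])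
  show "(\<lambda>x. f x * g x) \<in> borel_measurable (lebesgue_on {p..q})"
    using assms(1,3) by (intro borel_measurable_times absolutely_integrable_imp_borel_measurable) auto
  show "(\<lambda>x. (f x)\<^sup>2 + (g x)\<^sup>2) integrable_on {p..q}"
    using assms(2,4) by (intro integrable_add) (auto simp: absolutely_integrable_on_def)
  fix x
  show "norm (f x * g x) \<le> (f x)\<^sup>2 + (g x)\<^sup>2"
    using zero_le_power2[of "\<bar>f x\<bar> - \<bar>g x\<bar>"] mult_nonneg_nonneg[OF abs_ge_zero[of "f x"] abs_ge_zero[of "g x"]] zero_le_power2[of "\<bar>f x\<bar>"] zero_le_power2[of "\<bar>g x\<bar>"]
    unfolding power2_diff real_norm_def abs_mult power2_abs by linarith
qed auto

lemma negligible_iff_AE_Icc: "negligible {x\<in>{p..q}. \<not> P x} \<longleftrightarrow> (AE x in lebesgue_on {p..q::real}. P x)"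
proof -
  have "(AE x in lebesgue_on {p..q}. P x) \<longleftrightarrow> (AE x in lebesgue. x \<in> {p..q} \<longrightarrow> P x)"
    by (rule AE_restrict_space_iff) auto
  also have "\<dots> \<longleftrightarrow> negligible {x\<in>{p..q}. \<not> P x}"
    by (subst eventually_ae_filter_negligible) (auto simp: Collect_conj_eq[symmetric] intro: negligible_subset)
  finally show ?thesis by simp
qed

lemma negligible_iff_AE_Ioo: "negligible {x\<in>{p..q}. \<not> P x} \<longleftrightarrow> (AE x in lebesgue_on {p<..<q::real}. P x)"
proof -
  have "(AE x in lebesgue_on {p<..<q}. P x) \<longleftrightarrow> (AE x in lebesgue. x \<in> {p<..<q} \<longrightarrow> P x)"
    by (rule AE_restrict_space_iff) auto
  also have "\<dots> \<longleftrightarrow> negligible {x\<in>{p<..<q}. \<not> P x}"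
    by (subst eventually_ae_filter_negligible) (auto simp: Collect_conj_eq[symmetric] intro: negligible_subset)
  also have "\<dots> \<longleftrightarrow> negligible {x\<in>{p..q}. \<not> P x}"
  proof
    assume "negligible {x\<in>{p<..<q}. \<not> P x}"
    then have "negligible ({x\<in>{p<..<q}. \<not> P x} \<union> {p,q})" by (intro negligible_Un) auto
    then show "negligible {x\<in>{p..q}. \<not> P x}" by (rule negligible_subset) auto
  qed (auto intro: negligible_subset)
  finally show ?thesis by simp
qed

lemma integral_nonneg_eq_0_imp_negligible:
  fixes f :: "real \<Rightarrow> real"
  assumes "f absolutely_integrable_on {p..q}" "\<And>x. x \<in> {p..q} \<Longrightarrow> f x \<ge> 0" "integral {p..q} f = 0"
  shows "negligible {x\<in>{p..q}. f x \<noteq> 0}"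
proof -
  have i: "integrable (lebesgue_on {p..q}) f"
    by (rule absolutely_integrable_imp_integrable[OF assms(1)]) auto
  then have "integral\<^sup>L (lebesgue_on {p..q}) f = 0"
    using assms(3) by (simp add: lebesgue_integral_eq_integral)
  then have "AE x in lebesgue_on {p..q}. f x = 0"
    using i assms(2) by (subst (asm) integral_nonneg_eq_0_iff_AE) (auto intro!: AE_I2)
  then show ?thesis using negligible_iff_AE_Icc[of p q "\<lambda>x. f x = 0"] by simp
qed

text \<open>Continuous functions bounded by 1 and supported inside the interval converge almost
  everywhere to sgn f. Dominated convergence then turns orthogonality into
  \<open>\<integral> \<bar>f\<bar> = 0\<close>.\<close>

lemma fundamental_lemma:
  fixes f :: "real \<Rightarrow> real"
  assumes f: "f absolutely_integrable_on {p..q}"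
    and orth: "\<And>h \<eta>. continuous_on UNIV h \<Longrightarrow> \<eta> > 0 \<Longrightarrow> (\<And>x. x \<notin> {p+\<eta>..q-\<eta>} \<Longrightarrow> h x = 0)
      \<Longrightarrow> integral {p..q} (\<lambda>x. f x * h x) = 0"
  shows "negligible {x\<in>{p..q}. f x \<noteq> 0}"
proof -
  have "f \<in> borel_measurable (lebesgue_on {p..q})"
    using absolutely_integrable_imp_borel_measurable[OF f] by simp
  then have "(\<lambda>x. sgn (f x)) \<in> borel_measurable (lebesgue_on {p..q})"
    by measurable
  then have "(\<lambda>x. sgn (f x)) measurable_on {p..q}"
    by (subst measurable_on_iff_borel_measurable) auto
  then obtain N g where N: "negligible N" and g: "\<And>n. continuous_on UNIV (g n)"
    and lim: "\<And>x. x \<notin> N \<Longrightarrow> (\<lambda>n. g n x) \<longlonglongrightarrow> (if x \<in> {p..q} then sgn (f x) else 0)"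
    unfolding measurable_on_def by blast
  \<comment> \<open>A continuous cutoff: 0 within distance 1 / (n + 1) of the ends, and eventually 1
    at each interior point.\<close>
  define \<kappa> :: "nat \<Rightarrow> real \<Rightarrow> real" where "\<kappa> n x = max 0 (min 1 (real (Suc n) * min (x - p) (q - x) - 1))" for n x
  define s where "s n x = max (-1) (min 1 (g n x)) * \<kappa> n x" for n x
  have s1: "\<bar>s n x\<bar> \<le> 1" for n x
    unfolding s_def abs_mult by (rule mult_le_one) (auto simp: \<kappa>_def)
  have cs: "continuous_on UNIV (s n)" for n
    unfolding s_def \<kappa>_def by (intro continuous_intros g)
  have s0: "integral {p..q} (\<lambda>x. f x * s n x) = 0" for n
  proof (rule orth[OF cs, of "1 / Suc n"])
    fix x assume "x \<notin> {p + 1 / Suc n..q - 1 / Suc n}"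
    then have "min (x - p) (q - x) < 1 / Suc n" by auto
    then have "real (Suc n) * min (x - p) (q - x) < 1"
      by (simp add: field_simps)
    then show "s n x = 0" by (simp add: s_def \<kappa>_def)
  qed simp
  have slim: "(\<lambda>n. s n x) \<longlonglongrightarrow> sgn (f x)" if x: "x \<in> {p<..<q}" "x \<notin> N" for x
  proof -
    have "(\<lambda>n. max (-1) (min 1 (g n x))) \<longlonglongrightarrow> max (-1) (min 1 (sgn (f x)))"
      using lim[OF x(2)] x(1) by (intro tendsto_intros) auto
    moreover have "max (-1) (min 1 (sgn (f x))) = sgn (f x)"
      by (auto simp: sgn_if)
    moreover have "(\<lambda>n. \<kappa> n x) \<longlonglongrightarrow> 1"
    proof (rule tendsto_eventually)
      define m where "m = min (x - p) (q - x)"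
      have "m > 0" using x by (auto simp: m_def)
      obtain n0 where n0: "real n0 > 2 / m" using reals_Archimedean2 by blast
      show "eventually (\<lambda>n. \<kappa> n x = 1) sequentially"
        using eventually_ge_at_top[of n0]
      proof eventually_elim
        case (elim n)
        then have "2 / m < real (Suc n)" using n0 by linarith
        then have "2 < real (Suc n) * m" using \<open>m > 0\<close> by (simp add: field_simps)
        then show ?case by (simp add: \<kappa>_def m_def[symmetric])
      qed
    qed
    ultimately show ?thesis
      unfolding s_def using tendsto_mult by fastforce
  qed
  define N' where "N' = N \<union> {p,q}"
  have N': "negligible N'" unfolding N'_def using N by (intro negligible_Un) auto
  define F where "F n x = (if x \<in> N' then 0 else f x * s n x)" for n x
  have "(\<lambda>x. f x * s n x) integrable_on {p..q}" for n
    using absint_continuous_mult(1)[OF f continuous_on_subset[OF cs]]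
    by (auto simp: absolutely_integrable_on_def)
  then have iF: "F n integrable_on {p..q}" for n
    by (rule integrable_spike[OF _ N']) (auto simp: F_def)
  have F0: "integral {p..q} (F n) = 0" for n
    unfolding s0[of n, symmetric] by (rule integral_spike[OF N']) (auto simp: F_def)
  have ia: "(\<lambda>x. \<bar>f x\<bar>) integrable_on {p..q}" using f by (simp add: absolutely_integrable_on_def)
  have "(\<lambda>n. integral {p..q} (F n)) \<longlonglongrightarrow> integral {p..q} (\<lambda>x. if x \<in> N' then 0 else \<bar>f x\<bar>)"
  proof (rule dominated_convergence(2)[OF iF ia])
    fix n x
    have "\<bar>f x\<bar> * \<bar>s n x\<bar> \<le> \<bar>f x\<bar>" by (simp add: mult_left_le s1)
    then show "norm (F n x) \<le> \<bar>f x\<bar>" by (auto simp: F_def abs_mult)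
  next
    fix x assume x: "x \<in> {p..q}"
    show "(\<lambda>n. F n x) \<longlonglongrightarrow> (if x \<in> N' then 0 else \<bar>f x\<bar>)"
    proof (cases "x \<in> N'")
      case False
      then have "(\<lambda>n. f x * s n x) \<longlonglongrightarrow> f x * sgn (f x)"
        using x by (intro tendsto_intros slim) (auto simp: N'_def)
      then show ?thesis using False by (simp add: F_def abs_sgn)
    qed (simp add: F_def)
  qed
  then have "integral {p..q} (\<lambda>x. if x \<in> N' then 0 else \<bar>f x\<bar>) = 0"
    unfolding F0 using LIMSEQ_unique tendsto_const by blast
  moreover have "integral {p..q} (\<lambda>x. \<bar>f x\<bar>) = integral {p..q} (\<lambda>x. if x \<in> N' then 0 else \<bar>f x\<bar>)"
    by (rule integral_spike[OF N']) auto
  ultimately have "negligible {x\<in>{p..q}. \<bar>f x\<bar> \<noteq> 0}"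
    using f by (intro integral_nonneg_eq_0_imp_negligible) (auto simp: set_integrable_abs)
  then show ?thesis by simp
qed

lemma test_fun_prim:
  assumes "test_fun p q \<phi>"
  shows "prim p q \<phi> (deriv \<phi>)" "\<phi> p = 0" "\<phi> q = 0" "continuous_on {p..q} (deriv \<phi>)"
proof -
  obtain D where D: "\<And>x. (\<phi> has_vector_derivative D x) (at x)" "continuous_on UNIV D"
    using assms unfolding test_fun_def C1_differentiable_on_def by auto
  have "(\<phi> has_real_derivative D x) (at x)" for x
    using D(1) by (simp add: has_real_derivative_iff_has_vector_derivative)
  moreover then have "deriv \<phi> = D" by (intro ext DERIV_imp_deriv)
  ultimately show "prim p q \<phi> (deriv \<phi>)" "continuous_on {p..q} (deriv \<phi>)"
    using D(2) by (auto intro!: prim_C1 elim: continuous_on_subset)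
  have "{x. \<phi> x \<noteq> 0} \<subseteq> {p<..<q}"
    using assms closure_subset[of "{x. \<phi> x \<noteq> 0}"] unfolding test_fun_def by (meson subset_trans)
  then show "\<phi> p = 0" "\<phi> q = 0" by auto
qed

lemma test_fun_antiderivative:
  assumes "p < q" "continuous_on UNIV h" "\<eta> > 0" "\<And>x. x \<notin> {p+\<eta>..q-\<eta>} \<Longrightarrow> h x = 0"
    and int0: "integral {p..q} h = 0"
  obtains \<phi> where "test_fun p q \<phi>" "deriv \<phi> = h"
proof -
  \<comment> \<open>Starting at p - 1, where h is still 0, makes each x with x >= p an interior
    point of the integration range, so the derivative there is two-sided.\<close>
  define \<phi> where "\<phi> x = integral {p-1..x} h" for x
  have ih: "h integrable_on {a..b}" for a b
    using assms(2) by (intro integrable_continuous_real) (auto elim: continuous_on_subset)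
  have z: "\<phi> x = 0" if "x < p + \<eta>" for x
    unfolding \<phi>_def by (rule integral_unique, rule has_integral_is_0) (use that assms(4) in auto)
  have z': "\<phi> x = 0" if "x > q - \<eta>" for x
  proof (cases "x \<le> p")
    case True then show ?thesis using z assms by simp
  next
    case False
    have "\<phi> x = \<phi> p + integral {p..x} h" unfolding \<phi>_def
      using False by (intro Henstock_Kurzweil_Integration.integral_combine[symmetric] ih) auto
    then have 1: "\<phi> x = integral {p..x} h" using z[of p] assms(3) by simp
    have "integral {p..x} h = integral {p..q} h"
    proof (cases "x \<le> q")
      case True
      have "integral {p..x} h + integral {x..q} h = integral {p..q} h"
        using True False by (intro Henstock_Kurzweil_Integration.integral_combine ih) auto
      moreover have "integral {x..q} h = 0"
        by (rule integral_unique, rule has_integral_is_0) (use that assms(4) in auto)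
      ultimately show ?thesis by simp
    next
      case F: False
      have "integral {p..q} h + integral {q..x} h = integral {p..x} h"
        using F \<open>p < q\<close> by (intro Henstock_Kurzweil_Integration.integral_combine ih) auto
      moreover have "integral {q..x} h = 0"
        by (rule integral_unique, rule has_integral_is_0) (use assms(3,4) in auto)
      ultimately show ?thesis by simp
    qed
    then show ?thesis using 1 int0 by simp
  qed
  have d: "(\<phi> has_real_derivative h x) (at x)" for x
  proof (cases "x < p")
    case True
    have "((\<lambda>_. 0) has_real_derivative h x) (at x)" using True assms(3,4) by simp
    then show ?thesis
      by (rule has_field_derivative_transform_within_open[where S = "{..<p}"]) (use True z assms(3) in auto)
  next
    case False
    have "((\<lambda>u. integral {p-1..u} h) has_real_derivative h x) (at x within {p-1..x+1})"
      using False assms(2) by (intro integral_has_real_derivative) (auto elim: continuous_on_subset)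
    moreover have "at x within {p-1..x+1} = at x"
      using False by (intro at_within_interior) auto
    ultimately show ?thesis unfolding \<phi>_def[abs_def] by simp
  qed
  have "test_fun p q \<phi>"
  proof -
    have "closure {x. \<phi> x \<noteq> 0} \<subseteq> {p+\<eta>..q-\<eta>}"
      by (rule closure_minimal) (use z z' in \<open>force simp: not_less[symmetric]\<close>)+
    moreover from this have "compact (closure {x. \<phi> x \<noteq> 0})"
      using bounded_subset[OF bounded_closed_interval] by (auto simp: compact_eq_bounded_closed)
    moreover have "\<phi> C1_differentiable_on UNIV"
      unfolding C1_differentiable_on_def using d assms(2)
      by (auto simp: has_real_derivative_iff_has_vector_derivative)
    ultimately show ?thesis using assms(3) by (auto simp: test_fun_def)
  qed
  moreover have "deriv \<phi> = h" using d by (intro ext DERIV_imp_deriv)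
  ultimately show ?thesis using that by blast
qed

lemma prim_test_by_parts:
  assumes "prim p q U v" "test_fun p q \<phi>" "p < q"
  shows "integral {p..q} (\<lambda>x. U x * deriv \<phi> x) = - integral {p..q} (\<lambda>x. v x * \<phi> x)"
    and "(\<lambda>x. U x * deriv \<phi> x) absolutely_integrable_on {p..q}"
    and "(\<lambda>x. v x * \<phi> x) absolutely_integrable_on {p..q}"
proof -
  note T = test_fun_prim[OF assms(2)]
  show 1: "(\<lambda>x. U x * deriv \<phi> x) absolutely_integrable_on {p..q}"
    using prim_continuous[OF assms(1)] T(4) by (intro continuous_imp_absint continuous_intros)
  show 2: "(\<lambda>x. v x * \<phi> x) absolutely_integrable_on {p..q}"
    by (rule absint_continuous_mult(1)[OF prim_absint[OF assms(1)] prim_continuous[OF T(1)]])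
  have "integral {p..q} (\<lambda>x. v x * \<phi> x + U x * deriv \<phi> x) = 0"
    using primD(2)[OF prim_mult[OF assms(1) T(1)] order_refl less_imp_le[OF \<open>p < q\<close>] order_refl] T by simp
  then show "integral {p..q} (\<lambda>x. U x * deriv \<phi> x) = - integral {p..q} (\<lambda>x. v x * \<phi> x)"
    using 1 2 by (subst (asm) Henstock_Kurzweil_Integration.integral_add) (auto simp: absolutely_integrable_on_def)
qed

lemma prim_imp_H1_deriv:
  assumes "p < q" "prim p q U v" "(\<lambda>x. (v x)\<^sup>2) absolutely_integrable_on {p..q}"
  shows "H1_deriv p q U v"
proof -
  note cU = prim_continuous[OF assms(2)]
  show ?thesis
    unfolding H1_deriv_def L2_fun_iff
  proof (intro conjI allI impI)
    show "U absolutely_integrable_on {p..q}" "(\<lambda>x. (U x)\<^sup>2) absolutely_integrable_on {p..q}"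
      by (rule continuous_imp_absint[OF cU] continuous_imp_absint[OF continuous_on_power[OF cU]])+
    show "v absolutely_integrable_on {p..q}" "(\<lambda>x. (v x)\<^sup>2) absolutely_integrable_on {p..q}"
      by (rule prim_absint[OF assms(2)] assms(3))+
    fix \<phi> assume "test_fun p q \<phi>"
    note T = prim_test_by_parts[OF assms(2) this assms(1)]
    show "(\<integral>x. U x * deriv \<phi> x \<partial>lebesgue_on {p<..<q}) = - (\<integral>x. v x * \<phi> x \<partial>lebesgue_on {p<..<q})"
      unfolding lebesgue_on_Ioo_integral[OF T(2)] lebesgue_on_Ioo_integral[OF T(3)] by (rule T(1))
  qed
qed

text \<open>The argument of du Bois-Reymond: the difference d of u and a primitive of v is
  orthogonal to every mean-zero h supported inside, since such an h is the derivative of a test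
  function. Hence d is constant almost everywhere.\<close>

lemma H1_deriv_imp_prim:
  assumes "p < q" and H: "H1_deriv p q u v"
  obtains U where "prim p q U v" "negligible {x\<in>{p..q}. u x \<noteq> U x}"
    "(\<lambda>x. (v x)\<^sup>2) absolutely_integrable_on {p..q}"
proof -
  have au: "u absolutely_integrable_on {p..q}" and av: "v absolutely_integrable_on {p..q}"
    and av2: "(\<lambda>x. (v x)\<^sup>2) absolutely_integrable_on {p..q}"
    using H by (auto simp: H1_deriv_def L2_fun_iff)
  define V where "V x = integral {p..x} v" for x
  have V: "prim p q V v" unfolding V_def[abs_def] by (rule prim_integral[OF av])
  define d where "d x = u x - V x" for x
  have ad: "d absolutely_integrable_on {p..q}"
    unfolding d_def using au continuous_imp_absint[OF prim_continuous[OF V]] by auto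
  have id: "(\<lambda>x. d x * h x) integrable_on {p..q}" if "continuous_on UNIV h" for h
    using absint_continuous_mult(1)[OF ad, of h] continuous_on_subset[OF that]
    by (auto simp: absolutely_integrable_on_def)
  have ih: "h integrable_on {p..q}" if "continuous_on UNIV h" for h :: "real \<Rightarrow> real"
    using that by (intro integrable_continuous_real) (auto elim: continuous_on_subset)
  have d0: "integral {p..q} (\<lambda>x. d x * h x) = 0"
    if h: "continuous_on UNIV h" "\<eta> > 0" "\<And>x. x \<notin> {p+\<eta>..q-\<eta>} \<Longrightarrow> h x = 0" "integral {p..q} h = 0" for h :: "real \<Rightarrow> real" and \<eta>
  proof -
    obtain \<phi> where \<phi>: "test_fun p q \<phi>" "deriv \<phi> = h"
      using test_fun_antiderivative[OF \<open>p < q\<close> h] by blast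
    have uh: "(\<lambda>x. u x * h x) absolutely_integrable_on {p..q}"
      using absint_continuous_mult(1)[OF au] h(1) continuous_on_subset by blast
    note T = prim_test_by_parts[OF V \<phi>(1) \<open>p < q\<close>, unfolded \<phi>(2)]
    have "integral {p..q} (\<lambda>x. u x * h x) = - integral {p..q} (\<lambda>x. v x * \<phi> x)"
      using H \<phi> uh T(3) by (auto simp: H1_deriv_def lebesgue_on_Ioo_integral)
    moreover have "integral {p..q} (\<lambda>x. u x * h x - V x * h x) = integral {p..q} (\<lambda>x. u x * h x) - integral {p..q} (\<lambda>x. V x * h x)"
      using uh T(2) by (intro Henstock_Kurzweil_Integration.integral_diff) (auto simp: absolutely_integrable_on_def)
    ultimately show ?thesis using T(1) by (simp add: d_def algebra_simps)
  qed
  define e where "e = (q - p) / 4"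
  have e: "e > 0" using \<open>p < q\<close> by (simp add: e_def)
  \<comment> \<open>A fixed tent of nonzero mean, with peak value e at the midpoint; multiples of it
    correct the mean of an arbitrary h.\<close>
  define h0 where "h0 x = max 0 (min (x - (p + e)) (q - e - x))" for x
  have h0: "continuous_on UNIV h0" unfolding h0_def by (intro continuous_intros)
  have h0z: "h0 x = 0" if "x \<notin> {p+e..q-e}" for x
    using that by (auto simp: h0_def)
  have I0: "integral {p..q} h0 \<noteq> 0"
  proof
    assume "integral {p..q} h0 = 0"
    moreover have "continuous_on {p..q} h0" "\<And>x. h0 x \<ge> 0"
      using continuous_on_subset[OF h0] by (auto simp: h0_def)
    ultimately have "\<forall>x\<in>{p..q}. h0 x = 0"
      using integral_eq_0_iff[of p q h0] \<open>p < q\<close> by auto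
    moreover have "(p+q)/2 - (p + e) = e" "q - e - (p+q)/2 = e"
      by (simp_all add: e_def field_simps)
    then have "h0 ((p+q)/2) = e" using e by (simp add: h0_def)
    ultimately show False using \<open>p < q\<close> e by (auto dest!: bspec[of _ _ "(p+q)/2"])
  qed
  \<comment> \<open>This is the only candidate for the constant: it makes d - k orthogonal to
    \<open>h0\<close>.\<close>
  define k where "k = integral {p..q} (\<lambda>x. d x * h0 x) / integral {p..q} h0"
  have "negligible {x\<in>{p..q}. d x - k \<noteq> 0}"
  proof (rule fundamental_lemma)
    show "(\<lambda>x. d x - k) absolutely_integrable_on {p..q}"
      by (intro set_integral_diff(1) ad continuous_imp_absint continuous_intros)
  next
    fix h :: "real \<Rightarrow> real" and \<eta> assume h: "continuous_on UNIV h" "\<eta> > 0" "\<And>x. x \<notin> {p+\<eta>..q-\<eta>} \<Longrightarrow> h x = 0"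
    define c where "c = integral {p..q} h / integral {p..q} h0"
    have ch: "integral {p..q} (\<lambda>x. d x * (h x - c * h0 x)) = 0"
    proof (rule d0[where \<eta> = "min \<eta> e"])
      show "continuous_on UNIV (\<lambda>x. h x - c * h0 x)" using h(1) h0 by (intro continuous_intros)
      show "min \<eta> e > 0" using h(2) e by simp
      show "h x - c * h0 x = 0" if "x \<notin> {p + min \<eta> e..q - min \<eta> e}" for x
      proof -
        have "x \<notin> {p+\<eta>..q-\<eta>}" "x \<notin> {p+e..q-e}" using that by auto
        then show ?thesis using h(3) h0z by simp
      qed
      have "integral {p..q} (\<lambda>x. h x - c * h0 x) = integral {p..q} h - integral {p..q} (\<lambda>x. c * h0 x)"
        using ih[OF h(1)] ih[OF h0] by (intro Henstock_Kurzweil_Integration.integral_diff integrable_on_mult_right)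
      then show "integral {p..q} (\<lambda>x. h x - c * h0 x) = 0" using I0 by (simp add: c_def)
    qed
    have "integral {p..q} (\<lambda>x. d x * (h x - c * h0 x)) = integral {p..q} (\<lambda>x. d x * h x - c * (d x * h0 x))"
      by (simp add: algebra_simps)
    also have "\<dots> = integral {p..q} (\<lambda>x. d x * h x) - integral {p..q} (\<lambda>x. c * (d x * h0 x))"
      using id[OF h(1)] id[OF h0] by (intro Henstock_Kurzweil_Integration.integral_diff integrable_on_mult_right)
    also have "\<dots> = integral {p..q} (\<lambda>x. d x * h x) - k * integral {p..q} h"
      using I0 by (simp add: c_def k_def)
    finally have "integral {p..q} (\<lambda>x. d x * h x) - integral {p..q} (\<lambda>x. k * h x) = 0"
      using ch by simp
    moreover have "integral {p..q} (\<lambda>x. d x * h x - k * h x) = integral {p..q} (\<lambda>x. d x * h x) - integral {p..q} (\<lambda>x. k * h x)"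
      using id[OF h(1)] ih[OF h(1)] by (intro Henstock_Kurzweil_Integration.integral_diff integrable_on_mult_right)
    ultimately show "integral {p..q} (\<lambda>x. (d x - k) * h x) = 0"
      by (simp add: algebra_simps)
  qed
  then have "negligible {x\<in>{p..q}. u x \<noteq> V x + k}"
    by (simp add: d_def algebra_simps)
  moreover have "prim p q (\<lambda>x. V x + k) v"
    using prim_add[OF V prim_const] by simp
  ultimately show ?thesis using that av2 by blast
qed

section \<open>Uniqueness\<close>

definition ncos :: "real \<Rightarrow> nat \<Rightarrow> real \<Rightarrow> real" where
  "ncos L k x = cos (real k * pi / L * x)"

definition ncos' :: "real \<Rightarrow> nat \<Rightarrow> real \<Rightarrow> real" where
  "ncos' L k x = - (real k * pi / L) * sin (real k * pi / L * x)"

lemma lam_eq: "lam L k = (real k * pi / L)\<^sup>2"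
  by (simp add: lam_def power_mult_distrib power_divide)

lemma ncos_prim:
  shows "prim p q (ncos L k) (ncos' L k)"
    and "prim p q (ncos' L k) (\<lambda>x. - lam L k * ncos L k x)"
proof -
  have "prim p q (\<lambda>x. cos (c * x)) (\<lambda>x. - c * sin (c * x))"
    "prim p q (\<lambda>x. - c * sin (c * x)) (\<lambda>x. - c\<^sup>2 * cos (c * x))" for c
    by (rule prim_C1; auto intro!: continuous_intros derivative_eq_intros simp: power2_eq_square)+
  then show "prim p q (ncos L k) (ncos' L k)"
    and "prim p q (ncos' L k) (\<lambda>x. - lam L k * ncos L k x)"
    unfolding ncos_def[abs_def] ncos'_def[abs_def] lam_eq by blast+
qed

lemma ncos'_boundary: "L > 0 \<Longrightarrow> ncos' L k 0 = 0" "L > 0 \<Longrightarrow> ncos' L k L = 0"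
  by (simp_all add: ncos'_def mult.commute)

text \<open>Integration by parts; \<open>ncos'\<close> vanishes at 0 and L, so V may have any
  boundary values.\<close>

lemma ncos_weak:
  assumes "L > 0" and V: "prim 0 L V v"
  shows "integral {0..L} (\<lambda>x. ncos' L k x * v x) = lam L k * integral {0..L} (\<lambda>x. ncos L k x * V x)"
proof -
  have i: "(\<lambda>x. - lam L k * ncos L k x * V x + ncos' L k x * v x) integrable_on {0..L}"
    and e: "integral {0..L} (\<lambda>x. - lam L k * ncos L k x * V x + ncos' L k x * v x) = 0"
    using primD[OF prim_mult[OF ncos_prim(2) V], of 0 L] ncos'_boundary[of L k] \<open>L > 0\<close>
    by (auto simp: has_integral_integrable)
  have i1: "(\<lambda>x. ncos L k x * V x) integrable_on {0..L}"
    using prim_continuous[OF V] prim_continuous[OF ncos_prim(1)]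
    by (intro integrable_continuous_real continuous_intros)
  have "integral {0..L} (\<lambda>x. ncos' L k x * v x) =
    integral {0..L} (\<lambda>x. (- lam L k * ncos L k x * V x + ncos' L k x * v x) + lam L k * (ncos L k x * V x))"
    by (simp add: algebra_simps)
  also have "\<dots> = lam L k * integral {0..L} (\<lambda>x. ncos L k x * V x)"
    using integral_add[OF i integrable_on_mult_right[OF i1, of "lam L k"]] e by simp
  finally show ?thesis .
qed

text \<open>Testing each of the two eigenfunctions with the other gives the same integral multiplied
  by two different eigenvalues.\<close>

lemma ncos_orthogonal:
  assumes "L > 0" "j \<noteq> k"
  shows "integral {0..L} (\<lambda>x. ncos L j x * ncos L k x) = 0"
proof -
  have "lam L j * integral {0..L} (\<lambda>x. ncos L j x * ncos L k x) = lam L k * integral {0..L} (\<lambda>x. ncos L j x * ncos L k x)"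
    using ncos_weak[OF assms(1) ncos_prim(1)[where L = L and k = k], of j]
      ncos_weak[OF assms(1) ncos_prim(1)[where L = L and k = j], of k]
    by (simp add: mult.commute)
  moreover have "lam L j \<noteq> lam L k"
    using assms by (simp add: lam_def)
  ultimately show ?thesis by simp
qed

lemma ncos_norm_pos:
  assumes "L > 0"
  shows "integral {0..L} (\<lambda>x. ncos L k x * ncos L k x) > 0"
proof -
  have c: "continuous_on {0..L} (\<lambda>x. ncos L k x * ncos L k x)"
    by (intro continuous_intros prim_continuous[OF ncos_prim(1)])
  have "integral {0..L} (\<lambda>x. ncos L k x * ncos L k x) \<noteq> 0"
  proof
    assume "integral {0..L} (\<lambda>x. ncos L k x * ncos L k x) = 0"
    then have "\<forall>x\<in>{0..L}. ncos L k x * ncos L k x = 0"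
      using integral_eq_0_iff[OF c] assms by simp
    then show False using assms by (auto simp: ncos_def dest!: bspec[of _ _ 0])
  qed
  moreover have "integral {0..L} (\<lambda>x. ncos L k x * ncos L k x) \<ge> 0"
    by (rule Henstock_Kurzweil_Integration.integral_nonneg) (use c integrable_continuous_real in auto)
  ultimately show ?thesis by linarith
qed

lemma negligible_cos_zeros:
  assumes "c \<noteq> 0"
  shows "negligible {x::real. cos (c * x) = 0}"
proof -
  have "{x. cos (c * x) = 0} \<subseteq> range (\<lambda>i::int. of_int i * (pi/2) / c)"
    using assms by (auto simp: cos_zero_iff_int field_simps image_iff)
  then have "countable {x. cos (c * x) = 0}"
    by (rule countable_subset) simp
  then show ?thesis
    by (simp add: negligible_iff_null_sets countable_imp_null_set_lborel null_sets_completionI)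
qed

section \<open>The quadratic form of a potential above the n-th eigenvalue\<close>

text \<open>The absolute value makes \<open>b\<close> nonnegative at every point and not only almost
  everywhere; off a null set \<open>a\<close> is \<open>lam L n + b\<close>.\<close>

locale neumann_potential =
  fixes L :: real and n :: nat and a b :: "real \<Rightarrow> real"
  assumes L: "L > 0" and n: "n \<ge> 1"
    and a: "L1_fun 0 L a" and ab: "prec L (\<lambda>_. lam L n) a"
    and b_def: "b = (\<lambda>x. \<bar>a x - lam L n\<bar>)"
begin

lemma b_nonneg: "b x \<ge> 0"
  by (simp add: b_def)

lemma absint_diff: "(\<lambda>x. a x - lam L n) absolutely_integrable_on {0..L}"
  using a L1_fun_iff[of 0 L a] by (intro set_integral_diff(1) continuous_imp_absint[OF continuous_on_const]) auto

lemma absint_b: "b absolutely_integrable_on {0..L}"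
  unfolding b_def using set_integrable_abs[OF absint_diff] .

lemma L1_norm_b:
  assumes "0 \<le> p" "q \<le> L"
  shows "L1_norm p q (\<lambda>x. a x - lam L n) = integral {p..q} b"
  unfolding b_def by (rule L1_norm_eq, rule absint_imp_integrable(3)[OF absint_diff assms])

lemma a_eq: "negligible {x\<in>{0..L}. a x \<noteq> lam L n + b x}"
proof -
  have "negligible {x\<in>{0..L}. \<not> lam L n \<le> a x}"
    using ab negligible_iff_AE_Icc[of 0 L "\<lambda>x. lam L n \<le> a x"] by (simp add: prec_def)
  then show ?thesis by (rule negligible_subset) (auto simp: b_def)
qed

lemma b_not_null: "\<not> negligible {x\<in>{0..L}. b x \<noteq> 0}"
proof
  assume "negligible {x\<in>{0..L}. b x \<noteq> 0}"
  then have "negligible {x\<in>{0..L}. lam L n < a x}"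
    by (rule negligible_subset) (auto simp: b_def)
  then show False
    using ab by (simp add: prec_def negligible_iff_null_sets null_setsD1)
qed

lemma absint_potential:
  assumes "continuous_on {0..L} U" "continuous_on {0..L} V"
  shows "(\<lambda>x. (lam L n + b x) * U x * V x) absolutely_integrable_on {0..L}"
  by (intro absint_continuous_mult(1)[OF absint_continuous_mult(1)] assms
      set_integral_add(1)[OF continuous_imp_absint[OF continuous_on_const] absint_b])

lemma weak_form:
  assumes V: "prim 0 L V v" and U: "prim 0 L U u'" and u: "negligible {x\<in>{0..L}. u x \<noteq> U x}"
  shows "(\<integral>x. a x * u x * V x \<partial>lebesgue_on {0<..<L}) = integral {0..L} (\<lambda>x. (lam L n + b x) * U x * V x)"
proof -
  define N where "N = {x\<in>{0..L}. a x \<noteq> lam L n + b x} \<union> {x\<in>{0..L}. u x \<noteq> U x}"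
  have N: "negligible N" unfolding N_def using a_eq u by (rule negligible_Un)
  have "(\<lambda>x. (lam L n + b x) * U x * V x) absolutely_integrable_on {0..L}"
    by (rule absint_potential[OF prim_continuous[OF U] prim_continuous[OF V]])
  then have "(\<lambda>x. a x * u x * V x) absolutely_integrable_on {0..L}"
    by (rule absolutely_integrable_spike[OF _ N]) (auto simp: N_def)
  then have "(\<integral>x. a x * u x * V x \<partial>lebesgue_on {0<..<L}) = integral {0..L} (\<lambda>x. a x * u x * V x)"
    by (rule lebesgue_on_Ioo_integral)
  also have "\<dots> = integral {0..L} (\<lambda>x. (lam L n + b x) * U x * V x)"
    by (rule integral_spike[OF N]) (auto simp: N_def)
  finally show ?thesis .
qed

text \<open>This is the integrand of the bilinear form, with the values and the derivatives passed
  separately, so that it can be integrated over single pieces of a partition.\<close>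

definition form :: "(real \<Rightarrow> real) \<Rightarrow> (real \<Rightarrow> real) \<Rightarrow> (real \<Rightarrow> real) \<Rightarrow> (real \<Rightarrow> real) \<Rightarrow> real \<Rightarrow> real" where
  "form V v W w x = v x * w x - (lam L n + b x) * V x * W x"

lemma form_absint:
  assumes "prim 0 L V v" "(\<lambda>x. (v x)\<^sup>2) absolutely_integrable_on {0..L}"
    and "prim 0 L W w" "(\<lambda>x. (w x)\<^sup>2) absolutely_integrable_on {0..L}"
  shows "form V v W w absolutely_integrable_on {0..L}"
  unfolding form_def
proof (rule set_integral_diff(1))
  show "(\<lambda>x. v x * w x) absolutely_integrable_on {0..L}"
    using assms prim_absint by (intro absint_mult_of_squares) auto
  show "(\<lambda>x. (lam L n + b x) * V x * W x) absolutely_integrable_on {0..L}"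
    by (rule absint_potential[OF prim_continuous[OF assms(1)] prim_continuous[OF assms(3)]])
qed

text \<open>A solution lies in the kernel of the form: its continuous representative may be added to
  any function without changing the value of the quadratic form.\<close>

lemma form_solution_zero:
  assumes V: "prim 0 L V v" "(\<lambda>x. (v x)\<^sup>2) absolutely_integrable_on {0..L}"
    and U: "prim 0 L U u'" "(\<lambda>x. (u' x)\<^sup>2) absolutely_integrable_on {0..L}"
    and u: "negligible {x\<in>{0..L}. u x \<noteq> U x}"
    and weak: "\<And>w w'. H1_deriv 0 L w w' \<Longrightarrow>
        (\<integral>x. u' x * w' x \<partial>lebesgue_on {0<..<L}) = (\<integral>x. a x * u x * w x \<partial>lebesgue_on {0<..<L})"
  shows "integral {0..L} (form U u' V v) = 0"
proof -
  have i1: "(\<lambda>x. u' x * v x) absolutely_integrable_on {0..L}"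
    using V U prim_absint by (intro absint_mult_of_squares) auto
  have i2: "(\<lambda>x. (lam L n + b x) * U x * V x) absolutely_integrable_on {0..L}"
    by (rule absint_potential[OF prim_continuous[OF U(1)] prim_continuous[OF V(1)]])
  have "integral {0..L} (\<lambda>x. u' x * v x) = integral {0..L} (\<lambda>x. (lam L n + b x) * U x * V x)"
    using weak[OF prim_imp_H1_deriv[OF L V]] lebesgue_on_Ioo_integral[OF i1] weak_form[OF V(1) U(1) u] by simp
  then show ?thesis
    unfolding form_def using i1 i2
    by (subst Henstock_Kurzweil_Integration.integral_diff) (auto simp: absolutely_integrable_on_def)
qed

text \<open>The cosines are orthogonal, and so are their derivatives by the weak eigenvalue
  equation, so the part without \<open>b\<close> is diagonal. Both subtracted quantities are
  nonnegative, because \<open>lam L k \<le> lam L n\<close> for the indices that occur.\<close>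

lemma form_cosines:
  fixes c :: "nat \<Rightarrow> real"
  defines "W \<equiv> \<lambda>x. \<Sum>k\<le>n. c k * ncos L k x" and "w \<equiv> \<lambda>x. \<Sum>k\<le>n. c k * ncos' L k x"
  shows "integral {0..L} (form W w W w) =
    - (\<Sum>k\<le>n. (c k)\<^sup>2 * (lam L n - lam L k) * integral {0..L} (\<lambda>x. ncos L k x * ncos L k x))
    - integral {0..L} (\<lambda>x. b x * (W x)\<^sup>2)"
proof -
  define N where "N k = integral {0..L} (\<lambda>x. ncos L k x * ncos L k x)" for k
  have W: "prim 0 L W w"
    unfolding W_def w_def by (intro prim_sum prim_cmul ncos_prim) auto
  have w: "continuous_on {0..L} w"
    unfolding w_def by (intro continuous_intros prim_continuous[OF ncos_prim(2)])
  note cW = prim_continuous[OF W]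
  note cc = prim_continuous[OF ncos_prim(1)] prim_continuous[OF ncos_prim(2)]
  have m: "integral {0..L} (\<lambda>x. ncos L k x * W x) = c k * N k" if "k \<le> n" for k
  proof -
    have "integral {0..L} (\<lambda>x. ncos L k x * W x) = integral {0..L} (\<lambda>x. \<Sum>j\<le>n. c j * (ncos L k x * ncos L j x))"
      unfolding W_def by (simp add: sum_distrib_left algebra_simps)
    also have "\<dots> = (\<Sum>j\<le>n. c j * integral {0..L} (\<lambda>x. ncos L k x * ncos L j x))"
      by (subst integral_sum) (auto intro!: integrable_continuous_real continuous_intros cc)
    also have "\<dots> = (\<Sum>j\<le>n. if j = k then c k * N k else 0)"
      by (intro sum.cong) (auto simp: N_def ncos_orthogonal[OF L])
    finally show ?thesis using that by simp
  qed
  have "integral {0..L} (\<lambda>x. w x * w x) = integral {0..L} (\<lambda>x. \<Sum>k\<le>n. c k * (ncos' L k x * w x))"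
    by (subst (2) w_def) (simp add: sum_distrib_left mult.left_commute mult.commute)
  also have "\<dots> = (\<Sum>k\<le>n. c k * integral {0..L} (\<lambda>x. ncos' L k x * w x))"
    by (subst integral_sum) (auto intro!: integrable_continuous_real continuous_intros cc w)
  also have "\<dots> = (\<Sum>k\<le>n. (c k)\<^sup>2 * lam L k * N k)"
    by (intro sum.cong) (auto simp: ncos_weak[OF L W] m power2_eq_square)
  finally have 1: "integral {0..L} (\<lambda>x. w x * w x) = (\<Sum>k\<le>n. (c k)\<^sup>2 * lam L k * N k)" .
  have "integral {0..L} (\<lambda>x. W x * W x) = integral {0..L} (\<lambda>x. \<Sum>k\<le>n. c k * (ncos L k x * W x))"
    by (subst (2) W_def) (simp add: sum_distrib_left mult.left_commute mult.commute)
  also have "\<dots> = (\<Sum>k\<le>n. c k * integral {0..L} (\<lambda>x. ncos L k x * W x))"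
    by (subst integral_sum) (auto intro!: integrable_continuous_real continuous_intros cc cW)
  also have "\<dots> = (\<Sum>k\<le>n. (c k)\<^sup>2 * N k)"
    by (intro sum.cong) (auto simp: m power2_eq_square)
  finally have 2: "integral {0..L} (\<lambda>x. W x * W x) = (\<Sum>k\<le>n. (c k)\<^sup>2 * N k)" .
  have ib: "(\<lambda>x. b x * (W x)\<^sup>2) integrable_on {0..L}"
    using absint_continuous_mult(1)[OF absint_b continuous_on_power[OF cW]] by (simp add: absolutely_integrable_on_def)
  have iw: "(\<lambda>x. w x * w x) integrable_on {0..L}" and iW: "(\<lambda>x. lam L n * (W x * W x)) integrable_on {0..L}"
    using w cW by (auto intro!: integrable_continuous_real continuous_intros)
  have "integral {0..L} (form W w W w) = integral {0..L} (\<lambda>x. (w x * w x - lam L n * (W x * W x)) - b x * (W x)\<^sup>2)"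
    by (rule arg_cong[where f = "integral _"]) (auto simp: form_def power2_eq_square algebra_simps)
  also have "\<dots> = integral {0..L} (\<lambda>x. w x * w x) - lam L n * integral {0..L} (\<lambda>x. W x * W x)
     - integral {0..L} (\<lambda>x. b x * (W x)\<^sup>2)"
    by (simp add: Henstock_Kurzweil_Integration.integral_diff integrable_diff ib iw iW)
  also have "integral {0..L} (\<lambda>x. w x * w x) - lam L n * integral {0..L} (\<lambda>x. W x * W x)
     = - (\<Sum>k\<le>n. (c k)\<^sup>2 * (lam L n - lam L k) * N k)"
    unfolding 1 2 by (simp add: sum_distrib_left sum_subtractf sum_negf algebra_simps)
  finally show ?thesis unfolding N_def .
qed

text \<open>On a piece where V is not identically zero, the mixed estimate makes the contribution
  positive; elsewhere it is the integral of \<open>(v x)\<^sup>2\<close>. Adding the pieces from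
  left to right gives the sign, and a zero total excludes pieces of the first kind.\<close>

lemma form_pos_on_partition:
  assumes y: "partition_points L n y" "cond_B_at L n y a"
    and V: "prim 0 L V v" "(\<lambda>x. (v x)\<^sup>2) absolutely_integrable_on {0..L}"
    and V0: "\<And>i. i \<le> n \<Longrightarrow> V (y (2*i+1)) = 0"
  shows "integral {0..L} (form V v V v) \<ge> 0"
    and "integral {0..L} (form V v V v) = 0 \<Longrightarrow> x \<in> {0..L} \<Longrightarrow> V x = 0"
proof -
  define \<omega> where "\<omega> = real n * pi / L"
  have \<omega>: "\<omega> > 0" using L n by (simp add: \<omega>_def)
  have y0: "y 0 = 0" "y (2*n+2) = L" and ys: "\<And>i. i \<le> 2*n+1 \<Longrightarrow> y i < y (i+1)"
    using y(1) by (auto simp: partition_points_def)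
  have mono: "i \<le> j \<Longrightarrow> j \<le> 2*n+2 \<Longrightarrow> y i \<le> y j" for i j
  proof (induction j)
    case (Suc j)
    then show ?case using ys[of j] by (cases "i = Suc j") auto
  qed simp
  have yr: "0 \<le> y i" "y i \<le> L" if "i \<le> 2*n+2" for i
    using mono[of 0 i] mono[of i "2*n+2"] y0 that by auto
  define I where "I s t = integral {s..t} (form V v V v)" for s t
  note af = form_absint[OF V V]
  have piece: "0 < I (y i) (y (i+1))" if i: "i \<le> 2*n+1" and x: "x \<in> {y i..y (i+1)}" "V x \<noteq> 0" for i x
  proof -
    have r: "0 \<le> y i" "y (i+1) \<le> L" using yr i by auto
    have B: "y (i+1) - y i < L / (2 * real n)"
      "integral {y i..y (i+1)} b < \<omega> * cot (\<omega> * (y (i+1) - y i))"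
      using y(2) i L1_norm_b[OF r] unfolding cond_B_at_def \<omega>_def by auto
    have "0 < integral {y i..y (i+1)} (\<lambda>x. (v x)\<^sup>2 - (\<omega>\<^sup>2 + b x) * (V x)\<^sup>2)"
    proof (rule mixed_form_pos[where p = "y i" and q = "y (i+1)" and V = V and ?x1.0 = x, OF _ _ _ _ \<omega> ys[OF i] _ B(2) _ x])
      show "prim (y i) (y (i+1)) V v" by (rule prim_subinterval[OF V(1) r])
      show "(\<lambda>x. (v x)\<^sup>2) absolutely_integrable_on {y i..y (i+1)}" "b absolutely_integrable_on {y i..y (i+1)}"
        using absint_imp_integrable(3)[OF V(2) r] absint_imp_integrable(3)[OF absint_b r] by auto
      have "\<omega> * (y (i+1) - y i) < \<omega> * (L / (2 * real n))" using B(1) \<omega> by (rule mult_strict_left_mono)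
      also have "\<dots> = pi / 2" using L n by (simp add: \<omega>_def)
      finally show "\<omega> * (y (i+1) - y i) < pi / 2" .
      show "V (y i) = 0 \<or> V (y (i+1)) = 0"
      \<comment> \<open>The odd-numbered end of piece i is its right end for even i and its left end
        for odd i.\<close>
      proof (cases "even i")
        case True
        then obtain j where "i = 2 * j" by (elim evenE)
        then show ?thesis using V0[of j] i by auto
      next
        case False
        then obtain j where "i = 2 * j + 1" by (elim oddE)
        then show ?thesis using V0[of j] i by auto
      qed
    qed (rule b_nonneg)
    also have "(\<lambda>x. (v x)\<^sup>2 - (\<omega>\<^sup>2 + b x) * (V x)\<^sup>2) = form V v V v"
      by (auto simp: form_def lam_eq \<omega>_def power2_eq_square algebra_simps)
    finally show ?thesis unfolding I_def .
  qed
  have main: "0 \<le> I 0 (y k) \<and> (I 0 (y k) = 0 \<longrightarrow> (\<forall>x\<in>{0..y k}. V x = 0))" if "k \<le> 2*n+2" "k \<ge> 1" for k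
    using that(2,1)
  proof (induction k rule: dec_induct)
    case base
    show ?case
    proof (cases "\<exists>x\<in>{0..y 1}. V x \<noteq> 0")
      case True
      then show ?thesis using piece[of 0] y0 by fastforce
    next
      case False
      \<comment> \<open>Here V is zero, but v is a derivative only up to null sets; the sign of its
        square suffices.\<close>
      have "I 0 (y 1) = integral {0..y 1} (\<lambda>x. (v x)\<^sup>2)"
        unfolding I_def using False by (intro Henstock_Kurzweil_Integration.integral_cong) (auto simp: form_def power2_eq_square)
      moreover have "integral {0..y 1} (\<lambda>x. (v x)\<^sup>2) \<ge> 0"
        using absint_imp_integrable(1)[OF V(2), of 0 "y 1"] yr[of 1]
        by (intro Henstock_Kurzweil_Integration.integral_nonneg) auto
      ultimately show ?thesis using False by auto
    qed
  next
    case (step k)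
    have r: "0 \<le> y k" "y (k+1) \<le> L" "y k \<le> y (k+1)" using yr step mono[of k "k+1"] by auto
    have c: "I 0 (y k) + I (y k) (y (k+1)) = I 0 (y (k+1))"
      unfolding I_def using r absint_imp_integrable(1)[OF af, of 0 "y (k+1)"]
      by (intro Henstock_Kurzweil_Integration.integral_combine) auto
    show ?case
    proof (cases "\<exists>x\<in>{y k..y (k+1)}. V x \<noteq> 0")
      case True
      then have "0 < I (y k) (y (k+1))" using piece[of k] step by auto
      then show ?thesis using c step by auto
    next
      case False
      have "I (y k) (y (k+1)) = integral {y k..y (k+1)} (\<lambda>x. (v x)\<^sup>2)"
        unfolding I_def using False by (intro Henstock_Kurzweil_Integration.integral_cong) (auto simp: form_def power2_eq_square)
      moreover have "integral {y k..y (k+1)} (\<lambda>x. (v x)\<^sup>2) \<ge> 0"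
        using absint_imp_integrable(1)[OF V(2) r(1,2)]
        by (intro Henstock_Kurzweil_Integration.integral_nonneg) auto
      moreover have "x \<in> {0..y k} \<or> x \<in> {y k..y (k+1)}" if "x \<in> {0..y (Suc k)}" for x
        using that by auto
      ultimately show ?thesis using c step False by fastforce
    qed
  qed
  show "integral {0..L} (form V v V v) \<ge> 0"
    and "integral {0..L} (form V v V v) = 0 \<Longrightarrow> x \<in> {0..L} \<Longrightarrow> V x = 0"
    using main[of "2*n+2"] y0(2) unfolding I_def by auto
qed

text \<open>The form \<open>\<integral> v\<^sup>2 - a V\<^sup>2\<close> is positive definite on the functions vanishing at the \<open>n + 1\<close> odd
  partition points, but nonpositive on the span of the first \<open>n + 1\<close> Neumann eigenfunctions and of a
  solution; comparing dimensions, the spanning set is linearly dependent.\<close>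

lemma solution_trivial:
  assumes y: "partition_points L n y" "cond_B_at L n y a" and sol: "neumann_sol L a u"
  shows "trivial_fun L u"
proof -
  obtain u' where H: "H1_deriv 0 L u u'" and weak: "\<And>w w'. H1_deriv 0 L w w' \<Longrightarrow>
      (\<integral>x. u' x * w' x \<partial>lebesgue_on {0<..<L}) = (\<integral>x. a x * u x * w x \<partial>lebesgue_on {0<..<L})"
    using sol unfolding neumann_sol_def by blast
  obtain U where U: "prim 0 L U u'" "(\<lambda>x. (u' x)\<^sup>2) absolutely_integrable_on {0..L}"
    and uU: "negligible {x\<in>{0..L}. u x \<noteq> U x}"
    using H1_deriv_imp_prim[OF L H] by metis
  \<comment> \<open>Row i stands for the odd point \<open>y (2*i+1)\<close>, the columns 0 to n for
    the cosines and column n + 1 for U: n + 2 unknowns against n + 1 equations.\<close>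
  define A where "A i j = (if j \<le> n then ncos L j (y (2*i+1)) else U (y (2*i+1)))" for i j
  obtain c where c: "\<exists>j\<le>Suc n. c j \<noteq> 0" "\<And>i. i \<le> n \<Longrightarrow> (\<Sum>j\<le>Suc n. c j * A i j) = 0"
    using homogeneous_system_nontrivial[of "{..n}" "{..Suc n}" A] by auto
  define s where "s = c (Suc n)"
  define W w where "W = (\<lambda>x. \<Sum>k\<le>n. c k * ncos L k x)" and "w = (\<lambda>x. \<Sum>k\<le>n. c k * ncos' L k x)"
  define V v where "V = (\<lambda>x. W x + s * U x)" and "v = (\<lambda>x. w x + s * u' x)"
  have W: "prim 0 L W w"
    unfolding W_def w_def by (intro prim_sum prim_cmul ncos_prim) auto
  have w: "continuous_on {0..L} w"
    unfolding w_def by (intro continuous_intros prim_continuous[OF ncos_prim(2)])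
  have w2: "(\<lambda>x. (w x)\<^sup>2) absolutely_integrable_on {0..L}"
    by (rule continuous_imp_absint[OF continuous_on_power[OF w]])
  have V: "prim 0 L V v" unfolding V_def v_def by (intro prim_add W prim_cmul U)
  have wu: "(\<lambda>x. w x * u' x) absolutely_integrable_on {0..L}"
    using w2 U W prim_absint by (intro absint_mult_of_squares) auto
  have v2: "(\<lambda>x. (v x)\<^sup>2) absolutely_integrable_on {0..L}"
  proof -
    have "(\<lambda>x. (w x)\<^sup>2 + (2 * s) * (w x * u' x) + s\<^sup>2 * (u' x)\<^sup>2) absolutely_integrable_on {0..L}"
      by (intro set_integral_add(1) set_integrable_mult_right w2 wu U(2))
    moreover have "(v x)\<^sup>2 = (w x)\<^sup>2 + (2 * s) * (w x * u' x) + s\<^sup>2 * (u' x)\<^sup>2" for x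
      by (simp add: v_def power2_eq_square algebra_simps)
    ultimately show ?thesis by simp
  qed
  have V0: "V (y (2*i+1)) = 0" if "i \<le> n" for i
    using c(2)[OF that] by (simp add: V_def W_def A_def s_def)
  have "integral {0..L} (form V v V v) = integral {0..L} (\<lambda>x. form W w W w x + (2 * s * form U u' W w x + s\<^sup>2 * form U u' U u' x))"
    by (rule arg_cong[where f = "integral _"]) (auto simp: form_def V_def v_def power2_eq_square algebra_simps)
  also have "\<dots> = integral {0..L} (form W w W w) + (2 * s * integral {0..L} (form U u' W w) + s\<^sup>2 * integral {0..L} (form U u' U u'))"
    using form_absint[OF W w2 W w2] form_absint[OF U W w2] form_absint[OF U U]
    by (simp add: absolutely_integrable_on_def integral_add integrable_add integrable_on_mult_right)
  \<comment> \<open>U is in the kernel of the form, so neither the cross term nor the term in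
    \<open>s\<^sup>2\<close> contributes.\<close>
  finally have VW: "integral {0..L} (form V v V v) = integral {0..L} (form W w W w)"
    using form_solution_zero[OF W w2 U uU weak] form_solution_zero[OF U U uU weak] by simp
  define N where "N k = integral {0..L} (\<lambda>x. ncos L k x * ncos L k x)" for k
  have N: "N k > 0" for k unfolding N_def by (rule ncos_norm_pos[OF L])
  have term_nonneg: "(c k)\<^sup>2 * (lam L n - lam L k) * N k \<ge> 0" if "k \<le> n" for k
  proof -
    have "lam L k \<le> lam L n" using that by (simp add: lam_def divide_right_mono)
    then show ?thesis using N[of k] by simp
  qed
  have abW: "(\<lambda>x. b x * (W x)\<^sup>2) absolutely_integrable_on {0..L}"
    using absint_continuous_mult(1)[OF absint_b continuous_on_power[OF prim_continuous[OF W]]] .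
  have bW: "integral {0..L} (\<lambda>x. b x * (W x)\<^sup>2) \<ge> 0"
    using abW by (intro Henstock_Kurzweil_Integration.integral_nonneg) (auto simp: absolutely_integrable_on_def b_nonneg)
  have eq: "integral {0..L} (form W w W w) = - (\<Sum>k\<le>n. (c k)\<^sup>2 * (lam L n - lam L k) * N k)
      - integral {0..L} (\<lambda>x. b x * (W x)\<^sup>2)"
    unfolding W_def w_def N_def by (rule form_cosines)
  moreover have sum0: "(\<Sum>k\<le>n. (c k)\<^sup>2 * (lam L n - lam L k) * N k) \<ge> 0"
    by (intro sum_nonneg term_nonneg) auto
  moreover have "integral {0..L} (form V v V v) \<ge> 0"
    by (rule form_pos_on_partition(1)[OF y V v2 V0])
  \<comment> \<open>One number is nonnegative because V vanishes at the odd points, and equals minus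
    two nonnegative terms because W is a sum of cosines; hence all of them are 0.\<close>
  ultimately have Q0: "integral {0..L} (form V v V v) = 0"
    and S0: "(\<Sum>k\<le>n. (c k)\<^sup>2 * (lam L n - lam L k) * N k) = 0"
    and bW0: "integral {0..L} (\<lambda>x. b x * (W x)\<^sup>2) = 0"
    using VW bW by linarith+
  have Vz: "V x = 0" if "x \<in> {0..L}" for x
    by (rule form_pos_on_partition(2)[OF y V v2 V0 Q0 that])
  have ck: "c k = 0" if "k < n" for k
  proof -
    have "(c k)\<^sup>2 * (lam L n - lam L k) * N k = 0"
      using S0 that by (subst (asm) sum_nonneg_eq_0_iff) (auto intro: term_nonneg)
    moreover have "lam L k < lam L n"
      using that L unfolding lam_eq
      by (intro power_strict_mono divide_strict_right_mono mult_strict_right_mono) auto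
    ultimately show ?thesis using N[of k] by auto
  qed
  then have Wn: "W = (\<lambda>x. c n * ncos L n x)"
    unfolding W_def by (auto simp: lessThan_Suc_atMost[symmetric])
  \<comment> \<open>The diagonal term for k = n carries the factor 0 and gives no information.
    Instead \<open>b * W\<^sup>2\<close> is null and the zeros of the cosine are countable, so a
    nonzero coefficient would make b null, against the strict part of \<open>prec\<close>.\<close>
  have cn: "c n = 0"
  proof (rule ccontr)
    assume "c n \<noteq> 0"
    have "negligible {x\<in>{0..L}. b x * (W x)\<^sup>2 \<noteq> 0}"
      by (rule integral_nonneg_eq_0_imp_negligible[OF abW _ bW0]) (auto simp: b_nonneg)
    moreover have "negligible {x. cos (real n * pi / L * x) = 0}"
      using L n by (intro negligible_cos_zeros) auto
    ultimately have "negligible ({x\<in>{0..L}. b x * (W x)\<^sup>2 \<noteq> 0} \<union> {x. cos (real n * pi / L * x) = 0})"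
      by (rule negligible_Un)
    then have "negligible {x\<in>{0..L}. b x \<noteq> 0}"
      by (rule negligible_subset) (use \<open>c n \<noteq> 0\<close> in \<open>auto simp: Wn ncos_def\<close>)
    then show False using b_not_null by simp
  qed
  then have W0: "W x = 0" for x by (simp add: Wn)
  \<comment> \<open>All cosine coefficients are zero, so the nontrivial entry of c is the one that
    multiplies U.\<close>
  have "s \<noteq> 0"
    using c(1) ck cn unfolding s_def by (metis le_Suc_eq le_neq_implies_less)
  then have "U x = 0" if "x \<in> {0..L}" for x
    using Vz[OF that] W0 by (simp add: V_def)
  then have "negligible {x\<in>{0..L}. \<not> u x = 0}"
    using uU by (auto elim!: negligible_subset)
  then show ?thesis
    unfolding trivial_fun_def using negligible_iff_AE_Ioo[of 0 L "\<lambda>x. u x = 0"] by simp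
qed

end

lemma trivial_imp_neumann_sol:
  assumes "trivial_fun L u"
  shows "neumann_sol L a u"
proof -
  have ae: "AE x in lebesgue_on {0<..<L}. u x = 0"
    using assms by (simp add: trivial_fun_def)
  then have N: "negligible {x\<in>{0..L}. u x \<noteq> 0}"
    using negligible_iff_AE_Ioo[of 0 L "\<lambda>x. u x = 0"] by simp
  have z: "(\<lambda>x. 0::real) absolutely_integrable_on {0..L}" by auto
  have L2: "L2_fun 0 L u" "L2_fun 0 L (\<lambda>x. 0)"
    unfolding L2_fun_iff using z
    by (auto intro: absolutely_integrable_spike[OF z N])
  have "(\<integral>x. u x * f x \<partial>lebesgue_on {0<..<L}) = 0" for f
    by (rule integral_eq_zero_AE) (use ae in eventually_elim, simp)
  moreover have "(\<integral>x. a x * u x * f x \<partial>lebesgue_on {0<..<L}) = 0" for f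
    by (rule integral_eq_zero_AE) (use ae in eventually_elim, simp)
  ultimately show ?thesis
    unfolding neumann_sol_def H1_deriv_def using L2 by (intro exI[of _ "\<lambda>x. 0"]) auto
qed

section \<open>Convexity of the cotangent and partitions\<close>

text \<open>Strict convexity through the mean value theorem: the derivative
  \<open>- 1 / (sin t)\<^sup>2\<close> is strictly increasing on (0, pi/2).\<close>

lemma cot_tangent_less:
  fixes x z :: real
  assumes "0 < x" "x < pi/2" "0 < z" "z < pi/2" "x \<noteq> z"
  shows "cot z - (x - z) / (sin z)\<^sup>2 < cot x"
proof -
  have s: "sin t > 0" if "0 < t" "t < pi/2" for t :: real
    using that pi_gt_zero by (intro sin_gt_zero) linarith+
  have D: "(cot has_real_derivative - inverse ((sin t)\<^sup>2)) (at t)" if "0 < t" "t < pi/2" for t :: real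
    using s[OF that] by (intro DERIV_cot) auto
  have sm: "(sin t)\<^sup>2 < (sin t')\<^sup>2" if "0 < t" "t < t'" "t' < pi/2" for t t' :: real
    using that s[of t] sin_monotone_2pi[of t t'] by (intro power_strict_mono) auto
  show ?thesis
  proof (cases "x < z")
    case True
    then obtain t where t: "x < t" "t < z" "cot z - cot x = (z - x) * - inverse ((sin t)\<^sup>2)"
      using MVT2[of x z cot "\<lambda>t. - inverse ((sin t)\<^sup>2)"] D assms by force
    have "inverse ((sin z)\<^sup>2) < inverse ((sin t)\<^sup>2)"
      using t assms s[of t] by (intro less_imp_inverse_less sm) auto
    then have "(z - x) * inverse ((sin z)\<^sup>2) < (z - x) * inverse ((sin t)\<^sup>2)"
      using True by simp
    then show ?thesis using t(3) by (simp add: divide_inverse algebra_simps)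
  next
    case False
    then obtain t where t: "z < t" "t < x" "cot x - cot z = (x - z) * - inverse ((sin t)\<^sup>2)"
      using MVT2[of z x cot "\<lambda>t. - inverse ((sin t)\<^sup>2)"] D assms by force
    have "inverse ((sin t)\<^sup>2) < inverse ((sin z)\<^sup>2)"
      using t assms s[of z] by (intro less_imp_inverse_less sm) auto
    then have "(x - z) * inverse ((sin t)\<^sup>2) < (x - z) * inverse ((sin z)\<^sup>2)"
      using False assms(5) by simp
    then show ?thesis using t(3) by (simp add: divide_inverse algebra_simps)
  qed
qed

lemma cot_antimono:
  fixes x z :: real
  assumes "0 < x" "x \<le> z" "z < pi/2"
  shows "cot z \<le> cot x"
proof (cases "x = z")
  case False
  then have "(x - z) / (sin z)\<^sup>2 \<le> 0" using assms by (simp add: divide_nonpos_nonneg)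
  then show ?thesis using cot_tangent_less[of x z] assms False by linarith
qed simp

lemma scaled_cot_tangent:
  fixes \<omega> l l0 :: real
  assumes "\<omega> > 0" "0 < l" "\<omega> * l < pi/2" "0 < l0" "\<omega> * l0 < pi/2"
  shows "\<omega> * cot (\<omega> * l0) - (\<omega> / sin (\<omega> * l0))\<^sup>2 * (l - l0) \<le> \<omega> * cot (\<omega> * l)"
    and "l \<noteq> l0 \<Longrightarrow> \<omega> * cot (\<omega> * l0) - (\<omega> / sin (\<omega> * l0))\<^sup>2 * (l - l0) < \<omega> * cot (\<omega> * l)"
proof -
  show *: "\<omega> * cot (\<omega> * l0) - (\<omega> / sin (\<omega> * l0))\<^sup>2 * (l - l0) < \<omega> * cot (\<omega> * l)" if "l \<noteq> l0"
  proof -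
    have "cot (\<omega> * l0) - (\<omega> * l - \<omega> * l0) / (sin (\<omega> * l0))\<^sup>2 < cot (\<omega> * l)"
      using assms that by (intro cot_tangent_less) auto
    then have "\<omega> * (cot (\<omega> * l0) - (\<omega> * l - \<omega> * l0) / (sin (\<omega> * l0))\<^sup>2) < \<omega> * cot (\<omega> * l)"
      using assms(1) by (rule mult_strict_left_mono)
    then show ?thesis by (simp add: power2_eq_square algebra_simps diff_divide_distrib)
  qed
  show "\<omega> * cot (\<omega> * l0) - (\<omega> / sin (\<omega> * l0))\<^sup>2 * (l - l0) \<le> \<omega> * cot (\<omega> * l)"
    using * by (cases "l = l0") auto
qed

definition freq :: "real \<Rightarrow> nat \<Rightarrow> real" where
  "freq L n = real n * pi / L"

text \<open>The length of a piece in the equal partition, and the distance from an extremum to the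
  next zero in the near-extremal solutions.\<close>

definition cell :: "real \<Rightarrow> nat \<Rightarrow> real" where
  "cell L n = L / (2 * real n + 2)"

text \<open>L / (2 n) is exactly a quarter period of frequency \<omega>, and the equal pieces are
  strictly shorter since n < n + 1.\<close>

lemma freq_cell:
  assumes "L > 0" "n \<ge> 1"
  shows "freq L n > 0" "cell L n > 0" "freq L n * cell L n < pi/2" "freq L n * cell L n > 0"
    "lam L n = (freq L n)\<^sup>2" "freq L n * (L / (2 * real n)) = pi/2"
    "(2 * real n + 2) * cell L n = L"
proof -
  show "freq L n > 0" "cell L n > 0" using assms by (auto simp: freq_def cell_def)
  then show "freq L n * cell L n > 0" by simp
  have "freq L n * cell L n = pi/2 * (real n / (real n + 1))"
    using assms by (simp add: freq_def cell_def field_simps)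
  also have "\<dots> < pi/2 * 1" by (intro mult_strict_left_mono) auto
  finally show "freq L n * cell L n < pi/2" by simp
qed (use assms in \<open>auto simp: freq_def cell_def lam_eq field_simps\<close>)

lemma freq_quarter:
  assumes "L > 0" "n \<ge> 1" "l < L / (2 * real n)"
  shows "freq L n * l < pi/2"
  using mult_strict_left_mono[OF assms(3) freq_cell(1)[OF assms(1,2)]]
  unfolding freq_cell(6)[OF assms(1,2)] .

lemma cot_pos:
  fixes x :: real
  assumes "0 < x" "x < pi/2"
  shows "cot x > 0"
proof -
  have "sin x > 0" "cos x > 0"
    using assms pi_gt_zero by (auto intro!: sin_gt_zero cos_gt_zero)
  then show ?thesis by (simp add: cot_def)
qed

lemma partition_points_mono:
  assumes "partition_points L n y" "i \<le> j" "j \<le> 2*n+2"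
  shows "y i \<le> y j"
  using assms(2,3)
proof (induction j)
  case (Suc j)
  then have "y j < y (j+1)" using assms(1) by (auto simp: partition_points_def)
  then show ?case using Suc by (cases "i = Suc j") auto
qed simp

section \<open>Greedy construction of a partition\<close>

context neumann_potential
begin

text \<open>Condition (B) for one piece, in terms of \<open>b\<close>.\<close>

definition good :: "real \<Rightarrow> real \<Rightarrow> bool" where
  "good p q \<longleftrightarrow> p < q \<and> q - p < L / (2 * real n) \<and> integral {p..q} b < freq L n * cot (freq L n * (q - p))"

definition good_chain :: "nat \<Rightarrow> real \<Rightarrow> bool" where
  "good_chain k t \<longleftrightarrow> (\<exists>y. y 0 = 0 \<and> y k = t \<and> (\<forall>i<k. good (y i) (y (i+1))))"

lemma good_chain_0: "good_chain 0 0"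
  unfolding good_chain_def by (intro exI[of _ "\<lambda>_. 0"]) simp

lemma good_chain_Suc:
  "good_chain (Suc k) t \<longleftrightarrow> (\<exists>s. good_chain k s \<and> good s t)"
proof
  assume "good_chain (Suc k) t"
  then show "\<exists>s. good_chain k s \<and> good s t"
    unfolding good_chain_def by (metis Suc_eq_plus1 less_Suc_eq)
next
  assume "\<exists>s. good_chain k s \<and> good s t"
  then obtain y where y: "y 0 = 0" "\<And>i. i < k \<Longrightarrow> good (y i) (y (i+1))" "good (y k) t"
    unfolding good_chain_def by blast
  show "good_chain (Suc k) t"
    unfolding good_chain_def
    by (rule exI[of _ "y(Suc k := t)"]) (use y in \<open>auto simp: less_Suc_eq\<close>)
qed

lemma good_chain_nonneg: "good_chain k t \<Longrightarrow> t \<ge> 0"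
proof (induction k arbitrary: t)
  case (Suc k)
  then show ?case by (fastforce simp: good_chain_Suc good_def)
qed (auto simp: good_chain_def)

lemma integral_b_mono:
  assumes "0 \<le> p" "p \<le> p'" "q' \<le> q" "q \<le> L"
  shows "integral {p'..q'} b \<le> integral {p..q} b"
  using assms b_nonneg absint_imp_integrable(1)[OF absint_b]
  by (intro integral_subset_le) auto

text \<open>Shrinking a piece lowers its mass and raises its cotangent bound.\<close>

lemma good_subinterval:
  assumes "good p q" "0 \<le> p" "p \<le> p'" "p' < q'" "q' \<le> q" "q \<le> L"
  shows "good p' q'"
proof -
  note F = freq_cell[OF L n]
  have "freq L n * (q - p) < pi/2"
    using assms(1) by (intro freq_quarter[OF L n]) (auto simp: good_def)
  then have "cot (freq L n * (q - p)) \<le> cot (freq L n * (q' - p'))"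
    using assms F(1) by (intro cot_antimono) auto
  then have "freq L n * cot (freq L n * (q - p)) \<le> freq L n * cot (freq L n * (q' - p'))"
    using F(1) by simp
  moreover have "integral {p'..q'} b \<le> integral {p..q} b"
    using assms by (intro integral_b_mono) auto
  ultimately show ?thesis using assms by (auto simp: good_def)
qed

text \<open>The last piece is bisected. (B) asks for exactly 2 n + 2 pieces, while the greedy
  construction may stop earlier.\<close>

lemma good_chain_refine:
  assumes "good_chain (Suc k) L"
  shows "good_chain (Suc (Suc k)) L"
proof -
  obtain s where s: "good_chain k s" "good s L" using assms by (auto simp: good_chain_Suc)
  define r where "r = (s + L) / 2"
  have r: "s < r" "r < L" using s(2) by (auto simp: good_def r_def)
  have "s \<ge> 0" using good_chain_nonneg[OF s(1)] .
  then have "good s r" "good r L"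
    using good_subinterval[OF s(2)] r by auto
  then show ?thesis using s(1) by (auto simp: good_chain_Suc)
qed

text \<open>A length whose bound exceeds the total mass by 1, solved explicitly with the arctangent.
  The surplus 1 leaves room for the defect \<epsilon> < 1 of the greedy step.\<close>

lemma short_interval:
  obtains d where "d > 0" "d < L / (2 * real n)" "freq L n * cot (freq L n * d) = integral {0..L} b + 1"
proof -
  note F = freq_cell[OF L n]
  define I where "I = integral {0..L} b"
  have I: "I \<ge> 0" unfolding I_def using b_nonneg absint_imp_integrable(1)[OF absint_b]
    by (intro Henstock_Kurzweil_Integration.integral_nonneg) auto
  define \<theta> where "\<theta> = arctan (freq L n / (I + 1))"
  have \<theta>: "\<theta> > 0" "\<theta> < pi/2" using I F(1) arctan_ubound by (auto simp: \<theta>_def zero_less_arctan_iff)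
  have "cot \<theta> = (I + 1) / freq L n"
    using I F(1) by (simp add: \<theta>_def cot_altdef tan_arctan)
  moreover have "\<theta> / freq L n < L / (2 * real n)"
    using \<theta>(2) F(1,6) by (simp add: field_simps)
  ultimately show ?thesis
    using \<theta> F(1) by (intro that[of "\<theta> / freq L n"]) (auto simp: I_def)
qed

text \<open>The next partition point is placed where the strict inequality is missed by exactly \<open>\<epsilon>\<close>.\<close>

lemma greedy_step:
  assumes s: "0 \<le> s" "s < L" and \<epsilon>: "0 < \<epsilon>" "\<epsilon> < 1"
  shows "good s L \<or> (\<exists>t. s < t \<and> t < L \<and> good s t \<and>
    integral {s..t} b = freq L n * cot (freq L n * (t - s)) - \<epsilon>)"
proof -
  note F = freq_cell[OF L n]
  let ?\<omega> = "freq L n" and ?l = "L / (2 * real n)"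
  have cq: "?\<omega> * cot (?\<omega> * ?l) = 0" unfolding F(6) by (simp add: cot_def)
  obtain d where d: "d > 0" "d < ?l" "?\<omega> * cot (?\<omega> * d) = integral {0..L} b + 1"
    by (rule short_interval)
  show ?thesis
  proof (cases "s + d < L")
    case False
    have "good s L"
    proof -
      have "cot (?\<omega> * d) \<le> cot (?\<omega> * (L - s))"
        using False s d F(1) freq_quarter[OF L n d(2)] by (intro cot_antimono) auto
      then have "?\<omega> * cot (?\<omega> * d) \<le> ?\<omega> * cot (?\<omega> * (L - s))" using F(1) by simp
      moreover have "integral {s..L} b \<le> integral {0..L} b"
        using s by (intro integral_b_mono) auto
      ultimately show ?thesis using False s d by (auto simp: good_def)
    qed
    then show ?thesis by simp
  next
    case True
    define T where "T = min L (s + ?l)"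
    have T: "s + d < T" "T \<le> L" using True d by (auto simp: T_def)
    \<comment> \<open>The sought t is a zero of \<psi>, which is negative at s + d. At distance L /
      (2 n) from s the cotangent is 0, so \<psi> is at least \<epsilon> there; if \<psi> stays
      negative up to T, then T must be L.\<close>
    define \<psi> where "\<psi> t = integral {s..t} b - ?\<omega> * cot (?\<omega> * (t - s)) + \<epsilon>" for t
    have ib: "b integrable_on {s..T}"
      using absint_imp_integrable(1)[OF absint_b] s T by auto
    have less: "?\<omega> * (t - s) < pi" if "t \<le> T" for t
    proof -
      have "?\<omega> * (t - s) \<le> ?\<omega> * ?l" using that F(1) by (intro mult_left_mono) (auto simp: T_def)
      then show ?thesis using F(6) pi_gt_zero by linarith
    qed
    have c: "continuous_on {s+d..T} \<psi>"
      unfolding \<psi>_def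
    proof (intro continuous_intros ballI)
      show "continuous_on {s + d..T} (\<lambda>t. integral {s..t} b)"
        by (rule continuous_on_subset[OF indefinite_integral_continuous_1[OF ib]]) (use d in auto)
      fix t assume "t \<in> {s+d..T}"
      then show "sin (?\<omega> * (t - s)) \<noteq> 0"
        using less[of t] F(1) d(1) by (intro less_imp_neq[symmetric] sin_gt_zero mult_pos_pos) auto
    qed
    have 1: "\<psi> (s+d) < 0"
    proof -
      have "integral {s..s+d} b \<le> integral {0..L} b"
        using s d True by (intro integral_b_mono) auto
      then show ?thesis using d(3) \<epsilon> by (simp add: \<psi>_def)
    qed
    show ?thesis
    proof (cases "\<psi> T < 0")
      case neg: True
      have "T < s + ?l"
      proof (rule ccontr)
        assume "\<not> T < s + ?l"
        then have "T - s = ?l" by (auto simp: T_def)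
        then have "\<psi> T = integral {s..T} b + \<epsilon>" unfolding \<psi>_def using cq by simp
        moreover have "integral {s..T} b \<ge> 0"
          using ib b_nonneg by (intro Henstock_Kurzweil_Integration.integral_nonneg) auto
        ultimately show False using neg \<epsilon> by linarith
      qed
      then have "T = L" by (auto simp: T_def)
      then show ?thesis using neg \<epsilon> s \<open>T < s + ?l\<close> by (auto simp: good_def \<psi>_def)
    next
      case False
      then obtain t where t: "s + d \<le> t" "t \<le> T" "\<psi> t = 0"
        using IVT'[of \<psi> "s+d" 0 T] 1 c T by auto
      have eq: "integral {s..t} b = ?\<omega> * cot (?\<omega> * (t - s)) - \<epsilon>"
        using t(3) by (simp add: \<psi>_def)
      have "t < s + ?l"
      proof (rule ccontr)
        assume "\<not> t < s + ?l"
        then have "t - s = ?l" using t(2) by (auto simp: T_def)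
        then have "integral {s..t} b = - \<epsilon>" using eq cq by simp
        moreover have "integral {s..t} b \<ge> 0"
          using absint_imp_integrable(1)[OF absint_b, of s t] s t T b_nonneg
          by (intro Henstock_Kurzweil_Integration.integral_nonneg) auto
        ultimately show False using \<epsilon> by linarith
      qed
      then have g: "good s t" using t d \<epsilon> eq by (auto simp: good_def)
      show ?thesis
      proof (cases "t = L")
        case False
        then have "s < t" "t < L" using T t d by auto
        then show ?thesis using g eq by blast
      qed (use g in simp)
    qed
  qed
qed

text \<open>If the greedy construction did not reach \<open>L\<close> within \<open>2 n + 2\<close> steps, convexity of the
  cotangent would force \<open>\<integral> b\<close> to exceed its assumed bound.\<close>

lemma cond_B_if_norm_less:
  assumes "integral {0..L} b < (2 * real n + 2) * (freq L n * cot (freq L n * cell L n))"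
  shows "cond_B L n a"
proof -
  note F = freq_cell[OF L n]
  let ?\<omega> = "freq L n" and ?l = "cell L n"
  \<comment> \<open>Minus the slope, at the cell length, of the map sending l to
    \<open>\<omega> cot (\<omega> l)\<close>.\<close>
  define m where "m = (?\<omega> / sin (?\<omega> * ?l))\<^sup>2"
  have "sin (?\<omega> * ?l) > 0" using F pi_gt_zero by (intro sin_gt_zero) linarith+
  then have m: "m > 0" using F(1) by (simp add: m_def)
  \<comment> \<open>g is the gap in the assumed inequality; \<epsilon> is chosen so that 2 n + 2
    defects do not exceed it.\<close>
  define g where "g = (2 * real n + 2) * (?\<omega> * cot (?\<omega> * ?l)) - integral {0..L} b"
  define \<epsilon> where "\<epsilon> = min (1/2) (g / (2 * real n + 2))"
  have "g > 0" using assms by (simp add: g_def)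
  then have \<epsilon>: "0 < \<epsilon>" "\<epsilon> < 1" "\<epsilon> \<le> g / (2 * real n + 2)"
    by (auto simp: \<epsilon>_def)
  have \<epsilon>': "(2 * real n + 2) * \<epsilon> \<le> g"
    using \<epsilon>(3) by (simp add: field_simps)
  \<comment> \<open>Each step uses mass at least the tangent line at its length, minus \<epsilon>.
    The lengths telescope, so the sum depends on the chain only through k and t.\<close>
  have claim: "(\<exists>j\<le>k. good_chain j L) \<or> (\<exists>t. t < L \<and> good_chain k t \<and>
      integral {0..t} b \<ge> real k * (?\<omega> * cot (?\<omega> * ?l) + m * ?l - \<epsilon>) - m * t)" for k
  proof (induction k)
    case 0
    then show ?case using good_chain_0 L by (intro disjI2 exI[of _ 0]) auto
  next
    case (Suc k)
    then consider j where "j \<le> k" "good_chain j L"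
      | s where "s < L" "good_chain k s" "integral {0..s} b \<ge> real k * (?\<omega> * cot (?\<omega> * ?l) + m * ?l - \<epsilon>) - m * s"
      by blast
    then show ?case
    proof cases
      case 1
      then show ?thesis by (meson le_SucI)
    next
      case s: 2
      have s0: "0 \<le> s" by (rule good_chain_nonneg[OF s(2)])
      from greedy_step[OF s0 s(1) \<epsilon>(1,2)] show ?thesis
      proof
        assume "good s L"
        then have "good_chain (Suc k) L" using s(2) by (auto simp: good_chain_Suc)
        then show ?thesis by blast
      next
        assume "\<exists>t. s < t \<and> t < L \<and> good s t \<and> integral {s..t} b = ?\<omega> * cot (?\<omega> * (t - s)) - \<epsilon>"
        then obtain t where t: "s < t" "t < L" "good s t" "integral {s..t} b = ?\<omega> * cot (?\<omega> * (t - s)) - \<epsilon>"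
          by blast
        have "?\<omega> * (t - s) < pi/2"
          using t(3) by (intro freq_quarter[OF L n]) (auto simp: good_def)
        then have "?\<omega> * cot (?\<omega> * ?l) - m * (t - s - ?l) \<le> ?\<omega> * cot (?\<omega> * (t - s))"
          unfolding m_def using t(1) F by (intro scaled_cot_tangent(1)) auto
        moreover have "integral {0..s} b + integral {s..t} b = integral {0..t} b"
          using absint_imp_integrable(1)[OF absint_b, of 0 t] s0 t
          by (intro Henstock_Kurzweil_Integration.integral_combine) auto
        ultimately have "integral {0..t} b \<ge> real (Suc k) * (?\<omega> * cot (?\<omega> * ?l) + m * ?l - \<epsilon>) - m * t"
          using s(3) t(4) by (simp add: algebra_simps)
        then show ?thesis using t s(2) by (auto simp: good_chain_Suc)
      qed
    qed
  qed
  have "\<exists>j\<le>2*n+2. good_chain j L"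
  proof (rule ccontr)
    assume "\<not> (\<exists>j\<le>2*n+2. good_chain j L)"
    then obtain t where t: "t < L" "good_chain (2*n+2) t"
      "integral {0..t} b \<ge> real (2*n+2) * (?\<omega> * cot (?\<omega> * ?l) + m * ?l - \<epsilon>) - m * t"
      using claim[of "2*n+2"] by blast
    \<comment> \<open>Since 2 n + 2 cells have total length L, stopping at t < L would cost at least
      m (L - t) more than the whole mass of b.\<close>
    have "real (2*n+2) * (?\<omega> * cot (?\<omega> * ?l) + m * ?l - \<epsilon>) - m * t
      = (2 * real n + 2) * (?\<omega> * cot (?\<omega> * ?l)) - (2 * real n + 2) * \<epsilon> + m * ((2 * real n + 2) * ?l - t)"
      by (simp add: algebra_simps)
    also have "\<dots> \<ge> integral {0..L} b + m * (L - t)"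
      using \<epsilon>' unfolding g_def F(7) by linarith
    finally have "integral {0..L} b + m * (L - t) \<le> integral {0..t} b" using t(3) by linarith
    moreover have "integral {0..t} b \<le> integral {0..L} b"
      using t good_chain_nonneg[OF t(2)] by (intro integral_b_mono) auto
    moreover have "m * (L - t) > 0" using m t(1) by simp
    ultimately show False by linarith
  qed
  then obtain j where j: "j \<le> 2*n+2" "good_chain j L" by blast
  have "j \<noteq> 0"
    using j(2) L by (intro notI) (auto simp: good_chain_def)
  then have "1 \<le> j" by simp
  have "good_chain (2*n+2) L"
    using j(1) j(2) \<open>1 \<le> j\<close>
  proof (induction rule: inc_induct)
    case (step k)
    then show ?case using good_chain_refine[of "k-1"] by auto
  qed
  then obtain y where y: "y 0 = 0" "y (2*n+2) = L" "\<And>i. i < 2*n+2 \<Longrightarrow> good (y i) (y (i+1))"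
    unfolding good_chain_def by blast
  have P: "partition_points L n y"
    using y by (auto simp: partition_points_def good_def)
  have r: "0 \<le> y i" "y i \<le> L" if "i \<le> 2*n+2" for i
    using partition_points_mono[OF P, of 0 i] partition_points_mono[OF P, of i "2*n+2"] that y by auto
  have "cond_B_at L n y a"
    unfolding cond_B_at_def
  proof (intro allI impI)
    fix i assume i: "i \<le> 2*n+1"
    then have "L1_norm (y i) (y (i+1)) (\<lambda>x. a x - lam L n) = integral {y i..y (i+1)} b"
      using r by (intro L1_norm_b) auto
    then show "y (i+1) - y i < L / (2 * real n) \<and>
     L1_norm (y i) (y (i+1)) (\<lambda>x. a x - lam L n) < real n * pi / L * cot (real n * pi * (y (i+1) - y i) / L)"
      using y(3)[of i] i by (auto simp: good_def freq_def)
  qed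
  with P show ?thesis by (auto simp: cond_B_def)
qed

end

text \<open>Summing tangent lines at the cell length shows that the thresholds of an unequal
  partition add up to more than K. Scaling them all by one factor below 1 gives masses that satisfy
  (B) strictly and have total exactly K.\<close>

lemma unequal_partition_witness:
  assumes L: "L > 0" and n: "n \<ge> 1" and y: "partition_points L n y"
    and short: "\<And>k. k \<le> 2*n+1 \<Longrightarrow> y (k+1) - y k < L / (2 * real n)"
    and ne: "i \<le> 2*n+1" "j \<le> 2*n+1" "y (i+1) - y i \<noteq> y (j+1) - y j"
  obtains a where "L1_fun 0 L a" "prec L (\<lambda>_. lam L n) a" "cond_B_at L n y a"
    "L1_norm 0 L (\<lambda>x. a x - lam L n) = (2 * real n + 2) * (freq L n * cot (freq L n * cell L n))"
proof -
  note F = freq_cell[OF L n]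
  let ?\<omega> = "freq L n" and ?l = "cell L n"
  define K where "K = (2 * real n + 2) * (?\<omega> * cot (?\<omega> * ?l))"
  define len where "len k = y (k+1) - y k" for k
  define f where "f k = ?\<omega> * cot (?\<omega> * len k)" for k
  have y0: "y 0 = 0" "y (2*n+2) = L" using y by (auto simp: partition_points_def)
  have len: "len k > 0" "?\<omega> * len k < pi/2" "f k > 0" if "k \<le> 2*n+1" for k
  proof -
    show l: "len k > 0" using y that by (auto simp: partition_points_def len_def)
    show l': "?\<omega> * len k < pi/2"
      using freq_quarter[OF L n short[OF that]] by (simp add: len_def)
    show "f k > 0" unfolding f_def using F(1) l l' by (intro mult_pos_pos cot_pos) auto
  qed
  have r: "0 \<le> y k" "y k \<le> L" if "k \<le> 2*n+2" for k
    using partition_points_mono[OF y, of 0 k] partition_points_mono[OF y, of k "2*n+2"] that y0 by auto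
  have K: "K > 0" unfolding K_def using F by (intro mult_pos_pos cot_pos) auto
  have sum_l: "(\<Sum>k\<le>2*n+1. len k) = L"
    using sum_lessThan_telescope[of y "Suc (2*n+1)"] y0 unfolding lessThan_Suc_atMost len_def by simp
  have "K < (\<Sum>k\<le>2*n+1. f k)"
  proof -
    define m where "m = (?\<omega> / sin (?\<omega> * ?l))\<^sup>2"
    \<comment> \<open>Two lengths differ, so not both equal the cell length; at this piece the
      convexity inequality is strict.\<close>
    have "\<exists>h\<le>2*n+1. len h \<noteq> ?l" using ne unfolding len_def by metis
    then obtain h where h: "h \<le> 2*n+1" "len h \<noteq> ?l" by blast
    have "(\<Sum>k\<le>2*n+1. ?\<omega> * cot (?\<omega> * ?l) - m * (len k - ?l)) < (\<Sum>k\<le>2*n+1. f k)"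
    proof (rule sum_strict_mono_ex1)
      show "\<forall>k\<in>{..2*n+1}. ?\<omega> * cot (?\<omega> * ?l) - m * (len k - ?l) \<le> f k"
        unfolding m_def f_def using len F by (auto intro!: scaled_cot_tangent(1))
      show "\<exists>k\<in>{..2*n+1}. ?\<omega> * cot (?\<omega> * ?l) - m * (len k - ?l) < f k"
        unfolding m_def f_def using len F h by (intro bexI[of _ h]) (auto intro!: scaled_cot_tangent(2))
    qed simp
    also have "(\<Sum>k\<le>2*n+1. ?\<omega> * cot (?\<omega> * ?l) - m * (len k - ?l)) =
       K - m * ((\<Sum>k\<le>2*n+1. len k) - (2 * real n + 2) * ?l)"
      unfolding sum_subtractf sum_distrib_left[symmetric] by (simp add: K_def algebra_simps)
    also have "\<dots> = K" unfolding sum_l F(7) by simp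
    finally show ?thesis .
  qed
  define \<theta> where "\<theta> = K / (\<Sum>k\<le>2*n+1. f k)"
  have \<theta>: "0 < \<theta>" "\<theta> < 1" "\<theta> * (\<Sum>k\<le>2*n+1. f k) = K"
    using K \<open>K < _\<close> by (auto simp: \<theta>_def)
  \<comment> \<open>The constant whose mass over piece k is the fraction \<theta> of the
    threshold.\<close>
  define c where "c k = \<theta> * f k / len k" for k
  have c: "c k > 0" "c k * len k = \<theta> * f k" if "k \<le> 2*n+1" for k
    using len[OF that] \<theta> by (auto simp: c_def)
  define b where "b x = (\<Sum>k\<le>2*n+1. if x \<in> {y k<..<y (k+1)} then c k else 0)" for x
  have b0: "b x \<ge> 0" for x unfolding b_def using c(1) by (intro sum_nonneg) (auto intro: less_imp_le)
  have bk: "b x = c k" if k: "k \<le> 2*n+1" and x: "x \<in> {y k<..<y (k+1)}" for x k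
  proof -
    have "x \<notin> {y h<..<y (h+1)}" if "h \<le> 2*n+1" "h \<noteq> k" for h
      using partition_points_mono[OF y, of "h+1" k] partition_points_mono[OF y, of "k+1" h] that k x
      by (cases "h < k") auto
    then have "b x = (\<Sum>h\<le>2*n+1. if h = k then c k else 0)"
      unfolding b_def using x by (intro sum.cong) auto
    then show ?thesis using k by simp
  qed
  have bI: "(b has_integral (\<Sum>k\<le>2*n+1. c k * len k)) {0..L}"
    unfolding b_def
  proof (intro has_integral_sum)
    fix k assume "k \<in> {..2*n+1}"
    then have k: "k \<le> 2*n+1" by simp
    have "((\<lambda>x. c k) has_integral c k * len k) {y k..y (k+1)}"
      using has_integral_const_real[of "c k" "y k" "y (k+1)"] len(1)[OF k] by (simp add: len_def mult.commute)
    then have "((\<lambda>x. c k) has_integral c k * len k) {y k<..<y (k+1)}"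
      by (simp add: has_integral_Icc_iff_Ioo)
    moreover have "{y k<..<y (k+1)} \<subseteq> {0..L}" using r[of k] r[of "k+1"] k by auto
    ultimately show "((\<lambda>x. if x \<in> {y k<..<y (k+1)} then c k else 0) has_integral c k * len k) {0..L}"
      by (simp only: has_integral_restrict)
  qed simp
  have "(\<Sum>k\<le>2*n+1. c k * len k) = K"
    unfolding \<theta>(3)[symmetric] sum_distrib_left by (intro sum.cong) (auto simp: c(2))
  with bI have bK: "(b has_integral K) {0..L}" by simp
  define a where "a x = lam L n + b x" for x
  have ab: "b absolutely_integrable_on {0..L}"
    using bK b0 by (intro nonnegative_absolutely_integrable_1) auto
  have a1: "L1_fun 0 L a"
    unfolding L1_fun_iff a_def
    by (rule set_integral_add(1)[OF continuous_imp_absint[OF continuous_on_const] ab])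
  have norm: "L1_norm p q (\<lambda>x. a x - lam L n) = integral {p..q} b" if "0 \<le> p" "q \<le> L" for p q
    using L1_norm_eq[OF absint_imp_integrable(3)[OF ab that]] b0 by (simp add: a_def)
  have "prec L (\<lambda>_. lam L n) a"
    unfolding prec_def
  proof
    show "AE x in lebesgue_on {0..L}. lam L n \<le> a x" using b0 by (simp add: a_def)
    have "b \<in> borel_measurable borel" unfolding b_def by measurable
    then have "{x \<in> space borel. 0 \<le> x \<and> x \<le> L \<and> 0 < b x} \<in> sets borel" by measurable
    then have "{x \<in> {0..L}. lam L n < a x} \<in> sets lebesgue" by (simp add: a_def)
    moreover have "{y 0<..<y (0+1)} \<subseteq> {x \<in> {0..L}. lam L n < a x}"
      using bk[of 0] c(1)[of 0] r[of 1] y0 by (auto simp: a_def)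
    ultimately have "emeasure lebesgue {y 0<..<y (0+1)} \<le> emeasure lebesgue {x \<in> {0..L}. lam L n < a x}"
      by (intro emeasure_mono) auto
    moreover have "emeasure lebesgue {y 0<..<y (0+1)} > 0"
      using len(1)[of 0] by (simp add: len_def)
    ultimately show "0 < emeasure lebesgue {x \<in> {0..L}. lam L n < a x}" by (rule less_le_trans[rotated])
  qed
  moreover have "cond_B_at L n y a"
    unfolding cond_B_at_def
  proof (intro allI impI conjI)
    fix k assume k: "k \<le> 2*n+1"
    show "y (k+1) - y k < L / (2 * real n)" using short[OF k] .
    have "L1_norm (y k) (y (k+1)) (\<lambda>x. a x - lam L n) = integral {y k..y (k+1)} b"
      using k r by (intro norm) auto
    also have "\<dots> = integral {y k<..<y (k+1)} b" by (rule integral_open_interval_real)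
    also have "\<dots> = integral {y k<..<y (k+1)} (\<lambda>x. c k)"
      using bk[OF k] by (intro Henstock_Kurzweil_Integration.integral_cong) auto
    also have "\<dots> = c k * len k"
      using len(1)[OF k] by (simp add: integral_open_interval_real[symmetric] len_def)
    also have "\<dots> = \<theta> * f k" by (rule c(2)[OF k])
    also have "\<dots> < f k" using \<theta> len(3)[OF k] by simp
    finally show "L1_norm (y k) (y (k+1)) (\<lambda>x. a x - lam L n)
        < real n * pi / L * cot (real n * pi * (y (k+1) - y k) / L)"
      by (simp add: f_def len_def freq_def)
  qed
  moreover have "L1_norm 0 L (\<lambda>x. a x - lam L n) = K"
    using norm[of 0 L] bK by (simp add: integral_unique)
  ultimately show ?thesis using that a1 unfolding K_def by blast
qed

section \<open>Near-extremal potentials\<close>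

text \<open>The sign jumps only where h is 0. This makes the reflected derivative \<open>v\<close>
  continuous at the extrema.\<close>

lemma continuous_mult_sgn:
  fixes g h :: "real \<Rightarrow> real"
  assumes g: "\<And>x. isCont g x" and h: "\<And>x. isCont h x" and z: "\<And>x. g x = 0 \<Longrightarrow> h x = 0"
  shows "isCont (\<lambda>x. h x * sgn (g x)) x"
proof (cases "g x = 0")
  case True
  have "(h \<longlongrightarrow> 0) (at x)" using h[of x] z[OF True] by (simp add: isCont_def)
  then have "((\<lambda>x. h x * sgn (g x)) \<longlongrightarrow> 0) (at x)"
    by (rule Lim_null_comparison[rotated, OF tendsto_norm_zero]) (auto simp: abs_mult abs_sgn_eq)
  then show ?thesis using True by (simp add: isCont_def)
next
  case False
  then show ?thesis using g[of x] h[of x] unfolding isCont_def by (intro tendsto_intros) auto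
qed

lemma finite_progression:
  fixes \<alpha> \<beta> p q :: real
  assumes "\<beta> > 0"
  shows "finite {x \<in> {p..q}. \<exists>k::int. x = \<alpha> + \<beta> * of_int k}"
proof (rule finite_subset)
  show "{x \<in> {p..q}. \<exists>k::int. x = \<alpha> + \<beta> * of_int k} \<subseteq> (\<lambda>k. \<alpha> + \<beta> * of_int k) ` {\<lfloor>(p - \<alpha>) / \<beta>\<rfloor>..\<lceil>(q - \<alpha>) / \<beta>\<rceil>}"
  proof clarify
    fix x k assume "\<alpha> + \<beta> * of_int k \<in> {p..q}"
    then have "(p - \<alpha>) / \<beta> \<le> of_int k" "of_int k \<le> (q - \<alpha>) / \<beta>"
      using assms by (auto simp: field_simps)
    then have "k \<in> {\<lfloor>(p - \<alpha>) / \<beta>\<rfloor>..\<lceil>(q - \<alpha>) / \<beta>\<rceil>}"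
      by (auto simp: floor_le_iff le_ceiling_iff)
    then show "\<alpha> + \<beta> * of_int k \<in> (\<lambda>k. \<alpha> + \<beta> * of_int k) ` {\<lfloor>(p - \<alpha>) / \<beta>\<rfloor>..\<lceil>(q - \<alpha>) / \<beta>\<rceil>}"
      by blast
  qed
qed simp

text \<open>A quarter wave of length \<open>l0\<close> oscillates with frequency \<open>\<mu>\<close> up to distance \<open>\<eta>\<close> from its
  extremum and with frequency \<open>\<omega>\<close> up to its zero; \<open>match\<close> makes the two parts fit to first order.
  The signed position \<open>pos\<close> in a half wave, centred at the zero, is a triangle wave of period \<open>4 l0\<close>,
  so that \<open>wave \<circ> pos\<close> reflects the half wave at all extrema.\<close>

locale quarter_wave =
  fixes \<omega> l0 \<eta> \<mu> :: real
  assumes \<omega>: "\<omega> > 0" and \<eta>: "0 < \<eta>" "\<eta> < l0" and small: "\<omega> * l0 < pi/2" "\<mu> * \<eta> < pi/2"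
    and \<mu>: "\<omega> < \<mu>"
    and match: "\<omega> * cos (\<omega> * (l0 - \<eta>)) * cos (\<mu> * \<eta>) = \<mu> * sin (\<omega> * (l0 - \<eta>)) * sin (\<mu> * \<eta>)"
begin

definition r :: real where "r = l0 - \<eta>"
definition \<kappa> :: real where "\<kappa> = pi / (2 * l0)"
text \<open>The arcsine of a cosine gives the triangle wave by one continuous formula; the sign
  places x = 0 at position - l0, an extremum.\<close>

definition pos :: "real \<Rightarrow> real" where "pos x = - arcsin (cos (\<kappa> * x)) / \<kappa>"
definition clamp :: "real \<Rightarrow> real" where "clamp s = max (- r) (min r s)"
text \<open>The solution of w'' + \<open>\<mu>\<^sup>2\<close> w = 0 that agrees with - sin
  (\<omega> s) in value and slope at s = p.\<close>

definition glue :: "real \<Rightarrow> real \<Rightarrow> real" where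
  "glue p s = - (sin (\<omega> * p) * cos (\<mu> * (s - p)) + \<omega> / \<mu> * cos (\<omega> * p) * sin (\<mu> * (s - p)))"
definition glue' :: "real \<Rightarrow> real \<Rightarrow> real" where
  "glue' p s = \<mu> * sin (\<omega> * p) * sin (\<mu> * (s - p)) - \<omega> * cos (\<omega> * p) * cos (\<mu> * (s - p))"
text \<open>For \<open>\<bar>s\<bar> \<le> r\<close> the clamp is s itself, and
  \<open>glue s s\<close> is - sin (\<omega> s); beyond that the joint stays at r or - r. One
  formula covers all three regions, which makes continuity immediate.\<close>

definition wave :: "real \<Rightarrow> real" where "wave s = glue (clamp s) s"
definition wave' :: "real \<Rightarrow> real" where "wave' s = glue' (clamp s) s"
definition pot :: "real \<Rightarrow> real" where "pot s = (if \<bar>s\<bar> < r then \<omega>\<^sup>2 else \<mu>\<^sup>2)"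
definition u :: "real \<Rightarrow> real" where "u x = wave (pos x)"
definition v :: "real \<Rightarrow> real" where "v x = wave' (pos x) * sgn (sin (\<kappa> * x))"
definition a :: "real \<Rightarrow> real" where "a x = pot (pos x)"

lemma r: "r > 0" and \<kappa>: "\<kappa> > 0" "\<kappa> * l0 = pi/2" and \<mu>0: "\<mu> > 0"
  using \<eta> \<omega> \<mu> by (auto simp: r_def \<kappa>_def)

lemma cont: "continuous_on UNIV pos" "continuous_on A wave" "continuous_on A wave'"
  unfolding pos_def wave_def wave'_def glue_def glue'_def clamp_def using \<kappa> \<mu>0
  by (auto intro!: continuous_intros)

text \<open>The extrema are the multiples of 2 l0. Subtracting the nearest one changes the cosine at
  most by a sign, which the odd arcsine passes on and the absolute value removes.\<close>

lemma pos_nearest_extremum: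
  obtains k :: int where "\<bar>x - 2 * l0 * of_int k\<bar> \<le> l0" "\<bar>pos x\<bar> = l0 - \<bar>x - 2 * l0 * of_int k\<bar>"
proof -
  define k where "k = round (x / (2 * l0))"
  define t where "t = x - 2 * l0 * of_int k"
  have l0: "l0 > 0" using \<eta> by simp
  have "\<bar>x / (2 * l0) - of_int k\<bar> \<le> 1/2"
    using of_int_round_abs_le[of "x / (2 * l0)"] unfolding k_def by (simp add: abs_minus_commute)
  moreover have "x / (2 * l0) - of_int k = t / (2 * l0)" using l0 by (simp add: t_def field_simps)
  ultimately have t: "\<bar>t\<bar> \<le> l0" using l0 by (simp add: abs_divide field_simps)
  have "\<kappa> * x = \<kappa> * t + of_int k * pi"
    using l0 by (simp add: t_def \<kappa>_def field_simps)
  then have c: "cos (\<kappa> * x) = cos (\<kappa> * t) * cos (of_int k * pi)"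
    by (simp add: cos_add mult.commute[of _ pi])
  have "\<bar>cos (of_int k * pi)\<bar> = 1"
    using sin_npi_int[of k] sin_cos_squared_add[of "pi * of_int k"] by (simp add: power2_eq_1_iff mult.commute)
  then have pm: "cos (\<kappa> * x) = cos (\<kappa> * t) \<or> cos (\<kappa> * x) = - cos (\<kappa> * t)"
    unfolding c by (auto simp: abs_if split: if_splits)
  have kt: "\<bar>\<kappa> * t\<bar> \<le> pi/2"
    using mult_left_mono[OF t, of \<kappa>] \<kappa> by (simp add: abs_mult)
  have "cos (\<kappa> * t) = sin (pi/2 - \<bar>\<kappa> * t\<bar>)"
    by (simp add: sin_cos_eq abs_if)
  then have arc: "arcsin (cos (\<kappa> * t)) = pi/2 - \<bar>\<kappa> * t\<bar>"
    using kt arcsin_sin[of "pi/2 - \<bar>\<kappa> * t\<bar>"] by simp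
  have "\<bar>arcsin (cos (\<kappa> * x))\<bar> = pi/2 - \<bar>\<kappa> * t\<bar>"
    using pm arcsin_minus[of "cos (\<kappa> * t)"] arc kt by auto
  then have "\<bar>pos x\<bar> = (pi/2 - \<bar>\<kappa> * t\<bar>) / \<kappa>"
    using \<kappa> by (simp add: pos_def abs_divide)
  also have "\<dots> = l0 - \<bar>t\<bar>" using \<kappa> by (simp add: abs_mult field_simps flip: \<kappa>(2))
  finally show ?thesis using that t unfolding t_def by blast
qed

lemma pos_start:
  assumes "0 \<le> x" "x \<le> l0"
  shows "pos x = x - l0"
proof -
  have "\<kappa> * x \<le> pi/2" using mult_left_mono[OF assms(2), of \<kappa>] \<kappa> by simp
  then have "arcsin (cos (\<kappa> * x)) = pi/2 - \<kappa> * x"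
    using arcsin_sin[of "pi/2 - \<kappa> * x"] assms \<kappa> by (simp add: sin_cos_eq)
  then show ?thesis using \<kappa> by (simp add: pos_def field_simps flip: \<kappa>(2))
qed

lemma pos_at_extremum:
  assumes "sin (\<kappa> * x) = 0"
  shows "pos x = l0 \<or> pos x = - l0"
proof -
  have "cos (\<kappa> * x) = 1 \<or> cos (\<kappa> * x) = - 1"
    using assms sin_cos_squared_add[of "\<kappa> * x"] by (simp add: power2_eq_1_iff)
  then show ?thesis using \<kappa> by (auto simp: pos_def field_simps simp flip: \<kappa>(2))
qed

text \<open>This is the locale assumption \<open>match\<close>. It makes the reflection at an
  extremum continuously differentiable.\<close>

lemma wave'_at_extremum: "wave' l0 = 0" "wave' (- l0) = 0"
proof -
  have c: "clamp l0 = r" "clamp (- l0) = - r" using \<eta> r by (auto simp: clamp_def r_def)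
  have d: "l0 - r = \<eta>" "- l0 - - r = - \<eta>" by (auto simp: r_def)
  show "wave' l0 = 0" "wave' (- l0) = 0"
    unfolding wave'_def glue'_def c d using match[folded r_def] by simp_all
qed

lemma finite_exceptional: "finite {x \<in> {p..q}. sin (\<kappa> * x) = 0 \<or> \<bar>pos x\<bar> = r}"
proof (rule finite_subset)
  let ?P = "\<lambda>\<alpha>. {x \<in> {p..q}. \<exists>k::int. x = \<alpha> + 2 * l0 * of_int k}"
  show "finite (?P 0 \<union> ?P \<eta> \<union> ?P (- \<eta>))"
    using \<eta> by (intro finite_UnI finite_progression) auto
  show "{x \<in> {p..q}. sin (\<kappa> * x) = 0 \<or> \<bar>pos x\<bar> = r} \<subseteq> ?P 0 \<union> ?P \<eta> \<union> ?P (- \<eta>)"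
  proof
    fix x assume x: "x \<in> {x \<in> {p..q}. sin (\<kappa> * x) = 0 \<or> \<bar>pos x\<bar> = r}"
    obtain k :: int where k: "\<bar>x - 2 * l0 * of_int k\<bar> \<le> l0" "\<bar>pos x\<bar> = l0 - \<bar>x - 2 * l0 * of_int k\<bar>"
      by (rule pos_nearest_extremum)
    have "\<bar>pos x\<bar> = l0 \<or> \<bar>pos x\<bar> = r"
      using x pos_at_extremum[of x] \<eta> by auto
    then have "x = 0 + 2 * l0 * of_int k \<or> x = \<eta> + 2 * l0 * of_int k \<or> x = - \<eta> + 2 * l0 * of_int k"
      using k(2) unfolding r_def by linarith
    then show "x \<in> ?P 0 \<union> ?P \<eta> \<union> ?P (- \<eta>)" using x by blast
  qed
qed

lemma glue_deriv:
  "(glue p has_real_derivative glue' p s) (at s)"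
  "(glue' p has_real_derivative - (\<mu>\<^sup>2 * glue p s)) (at s)"
proof -
  have *: "((\<lambda>s. A * cos (\<mu> * (s - p)) + B * sin (\<mu> * (s - p))) has_real_derivative
      \<mu> * (B * cos (\<mu> * (s - p)) - A * sin (\<mu> * (s - p)))) (at s)" for A B
    by (rule derivative_eq_intros refl)+ (simp add: right_diff_distrib)
  have e1: "glue p = (\<lambda>s. - sin (\<omega> * p) * cos (\<mu> * (s - p)) + - (\<omega> / \<mu> * cos (\<omega> * p)) * sin (\<mu> * (s - p)))"
    by (simp add: glue_def fun_eq_iff)
  have e2: "\<mu> * (- (\<omega> / \<mu> * cos (\<omega> * p)) * cos (\<mu> * (s - p)) - - sin (\<omega> * p) * sin (\<mu> * (s - p))) = glue' p s"
    using \<mu>0 by (simp add: glue'_def distrib_left right_diff_distrib)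
  show "(glue p has_real_derivative glue' p s) (at s)"
    unfolding e1 e2[symmetric] by (rule *)
  have e3: "glue' p = (\<lambda>s. - (\<omega> * cos (\<omega> * p)) * cos (\<mu> * (s - p)) + \<mu> * sin (\<omega> * p) * sin (\<mu> * (s - p)))"
    by (simp add: glue'_def fun_eq_iff)
  have e4: "\<mu> * (\<mu> * sin (\<omega> * p) * cos (\<mu> * (s - p)) - - (\<omega> * cos (\<omega> * p)) * sin (\<mu> * (s - p))) = - (\<mu>\<^sup>2 * glue p s)"
  proof -
    have "\<mu> * (\<mu> * A * c - - B * d) = - (\<mu>\<^sup>2 * - (A * c + B / \<mu> * d))" for A B c d :: real
      using \<mu>0 by (simp add: power2_eq_square field_simps)
    from this[of "sin (\<omega> * p)" "cos (\<mu> * (s - p))" "\<omega> * cos (\<omega> * p)" "sin (\<mu> * (s - p))"]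
    show ?thesis by (simp add: glue_def)
  qed
  show "(glue' p has_real_derivative - (\<mu>\<^sup>2 * glue p s)) (at s)"
    unfolding e3 e4[symmetric] by (rule *)
qed

lemma wave_deriv:
  assumes "\<bar>s\<bar> \<noteq> r"
  shows "(wave has_real_derivative wave' s) (at s)"
    and "(wave' has_real_derivative - (pot s * wave s)) (at s)"
proof -
  consider "s \<in> {-r<..<r}" | "s \<in> {r<..}" | "s \<in> {..<-r}" using assms by fastforce
  then have "(wave has_real_derivative wave' s) (at s) \<and> (wave' has_real_derivative - (pot s * wave s)) (at s)"
  proof cases
    case 1
    have e: "- sin (\<omega> * t) = wave t" "- \<omega> * cos (\<omega> * t) = wave' t" if "t \<in> {-r<..<r}" for t
      using that by (auto simp: wave_def wave'_def glue_def glue'_def clamp_def min_absorb2 max_absorb2)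
    have "((\<lambda>s. - sin (\<omega> * s)) has_real_derivative wave' s) (at s)"
      "((\<lambda>s. - \<omega> * cos (\<omega> * s)) has_real_derivative - (pot s * wave s)) (at s)"
      unfolding e[OF 1, symmetric] using 1
      by (auto intro!: derivative_eq_intros simp: pot_def power2_eq_square)
    then show ?thesis
      using e 1 by (auto intro: has_field_derivative_transform_within_open[of _ _ _ "{-r<..<r}"])
  next
    case 2
    have e: "glue r t = wave t" "glue' r t = wave' t" if "t \<in> {r<..}" for t
      using that r by (auto simp: wave_def wave'_def clamp_def)
    have "(glue r has_real_derivative wave' s) (at s)"
      "(glue' r has_real_derivative - (pot s * wave s)) (at s)"
      unfolding e[OF 2, symmetric] using 2 r glue_deriv by (auto simp: pot_def)
    then show ?thesis
      using e 2 by (auto intro: has_field_derivative_transform_within_open[of _ _ _ "{r<..}"])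
  next
    case 3
    have e: "glue (- r) t = wave t" "glue' (- r) t = wave' t" if "t \<in> {..<-r}" for t
      using that r by (auto simp: wave_def wave'_def clamp_def)
    have "(glue (- r) has_real_derivative wave' s) (at s)"
      "(glue' (- r) has_real_derivative - (pot s * wave s)) (at s)"
      unfolding e[OF 3, symmetric] using 3 r glue_deriv by (auto simp: pot_def)
    then show ?thesis
      using e 3 by (auto intro: has_field_derivative_transform_within_open[of _ _ _ "{..<-r}"])
  qed
  then show "(wave has_real_derivative wave' s) (at s)"
    and "(wave' has_real_derivative - (pot s * wave s)) (at s)" by auto
qed

lemma pos_deriv:
  assumes "sin (\<kappa> * x) \<noteq> 0"
  shows "(pos has_real_derivative sgn (sin (\<kappa> * x))) (at x)"
proof -
  have sq: "1 - (cos (\<kappa> * x))\<^sup>2 = (sin (\<kappa> * x))\<^sup>2" by (simp add: cos_squared_eq)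
  have "(cos (\<kappa> * x))\<^sup>2 < 1"
    using assms sq zero_less_power2[of "sin (\<kappa> * x)"] by linarith
  then have "-1 < cos (\<kappa> * x)" "cos (\<kappa> * x) < 1"
    by (auto simp: abs_square_less_1 abs_less_iff)
  then have A: "(arcsin has_real_derivative inverse (sqrt (1 - (cos (\<kappa> * x))\<^sup>2))) (at (cos (\<kappa> * x)))"
    by (rule DERIV_arcsin)
  have "((\<lambda>x. cos (\<kappa> * x)) has_real_derivative - \<kappa> * sin (\<kappa> * x)) (at x)"
    by (auto intro!: derivative_eq_intros)
  from DERIV_cmult[OF DERIV_chain2[OF A this], of "- 1 / \<kappa>"]
  have "(pos has_real_derivative - 1 / \<kappa> * (inverse (sqrt ((sin (\<kappa> * x))\<^sup>2)) * (- \<kappa> * sin (\<kappa> * x)))) (at x)"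
    unfolding sq pos_def[abs_def] by simp
  moreover have "- 1 / \<kappa> * (inverse (sqrt ((sin (\<kappa> * x))\<^sup>2)) * (- \<kappa> * sin (\<kappa> * x))) = sgn (sin (\<kappa> * x))"
    using \<kappa> assms by (simp add: sgn_real_def field_simps abs_if)
  ultimately show ?thesis by simp
qed

lemma isCont_u_v: "isCont u x" "isCont v x"
proof -
  have p: "isCont pos x" for x
    using cont(1) by (simp add: continuous_on_eq_continuous_at)
  have w: "isCont wave x" "isCont wave' x" for x
    using cont(2)[of UNIV] cont(3)[of UNIV] by (simp_all add: continuous_on_eq_continuous_at)
  show "isCont u x" unfolding u_def[abs_def] using isCont_o2[OF p w(1)] .
  show "isCont v x" unfolding v_def[abs_def]
  proof (rule continuous_mult_sgn)
    show "isCont (\<lambda>x. wave' (pos x)) x" for x using isCont_o2[OF p w(2)] .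
    show "wave' (pos x) = 0" if "sin (\<kappa> * x) = 0" for x
      using pos_at_extremum[OF that] wave'_at_extremum by auto
  qed (intro continuous_intros)
qed

lemma u_v_deriv:
  assumes "sin (\<kappa> * x) \<noteq> 0" "\<bar>pos x\<bar> \<noteq> r"
  shows "(u has_real_derivative v x) (at x)" "(v has_real_derivative - (a x * u x)) (at x)"
proof -
  define \<sigma> where "\<sigma> = sgn (sin (\<kappa> * x))"
  \<comment> \<open>The slope of \<open>pos\<close> enters once in v and once more when v is
    differentiated, so the reflected wave solves an equation without sign.\<close>
  have \<sigma>: "\<sigma> * \<sigma> = 1" using assms by (auto simp: \<sigma>_def sgn_real_def)
  show "(u has_real_derivative v x) (at x)"
    unfolding u_def[abs_def] v_def by (rule DERIV_chain2[OF wave_deriv(1)[OF assms(2)] pos_deriv[OF assms(1)]])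
  have "((\<lambda>y. wave' (pos y) * \<sigma>) has_real_derivative - (pot (pos x) * wave (pos x)) * \<sigma> * \<sigma>) (at x)"
    unfolding \<sigma>_def
    by (rule DERIV_cmult_right[OF DERIV_chain2[OF wave_deriv(2)[OF assms(2)] pos_deriv[OF assms(1)]]])
  then have d: "((\<lambda>y. wave' (pos y) * \<sigma>) has_real_derivative - (a x * u x)) (at x)"
    unfolding a_def u_def mult.assoc \<sigma> by simp
  show "(v has_real_derivative - (a x * u x)) (at x)"
  proof (rule has_field_derivative_transform_within_open[OF d])
    show "open {y. 0 < sin (\<kappa> * y) * \<sigma>}" by (intro open_Collect_less continuous_intros)
    show "x \<in> {y. 0 < sin (\<kappa> * y) * \<sigma>}" using assms by (auto simp: \<sigma>_def sgn_real_def)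
    fix y assume "y \<in> {y. 0 < sin (\<kappa> * y) * \<sigma>}"
    then have "sgn (sin (\<kappa> * y)) = \<sigma>"
      using assms unfolding \<sigma>_def by (auto simp: sgn_real_def split: if_splits)
    then show "wave' (pos y) * \<sigma> = v y" by (simp add: v_def)
  qed
qed

lemma a_absint: "a absolutely_integrable_on {p..q}"
proof (rule measurable_bounded_by_integrable_imp_absolutely_integrable)
  have "pos \<in> borel_measurable borel" by (rule borel_measurable_continuous_onI[OF cont(1)])
  then have "a \<in> borel_measurable borel" unfolding a_def[abs_def] pot_def by measurable
  then have "a \<in> borel_measurable lborel" by simp
  then have "a \<in> borel_measurable lebesgue" by (rule measurable_completion)
  then show "a \<in> borel_measurable (lebesgue_on {p..q})"
    by (rule measurable_restrict_space1)
  show "(\<lambda>x. \<omega>\<^sup>2 + \<mu>\<^sup>2) integrable_on {p..q}" by (intro integrable_continuous_real continuous_intros)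
qed (auto simp: a_def pot_def)

lemma a_ge: "a x \<ge> \<omega>\<^sup>2"
  using \<omega> \<mu> by (auto simp: a_def pot_def intro!: power_mono)

lemma u_v_prim:
  shows "prim p q u v" "prim p q v (\<lambda>x. - (a x * u x))"
proof -
  have cu: "continuous_on {p..q} u" and cv: "continuous_on {p..q} v"
    using isCont_u_v by (auto intro: continuous_at_imp_continuous_on)
  show "prim p q u v"
    by (rule prim_deriv_except_finite[OF finite_exceptional[of p q] cu]) (use u_v_deriv continuous_imp_absint[OF cv] in auto)
  have "(\<lambda>x. - (a x * u x)) absolutely_integrable_on {p..q}"
    using absint_continuous_mult(1)[OF a_absint continuous_on_minus[OF cu]] by simp
  then show "prim p q v (\<lambda>x. - (a x * u x))"
    by (intro prim_deriv_except_finite[OF finite_exceptional[of p q] cv]) (use u_v_deriv in auto)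
qed

text \<open>The condition on L places the right end at an extremum, as 0 is. So v vanishes at both
  ends and integration by parts has no boundary terms, whatever the test function.\<close>

lemma neumann_sol_u:
  assumes "L > 0" "sin (\<kappa> * L) = 0"
  shows "neumann_sol L a u"
proof -
  note cu = prim_continuous[OF u_v_prim(1)] and cv = prim_continuous[OF u_v_prim(2)]
  have H: "H1_deriv 0 L u v"
    by (rule prim_imp_H1_deriv[OF assms(1) u_v_prim(1) continuous_imp_absint[OF continuous_on_power[OF cv]]])
  have "(\<integral>x. v x * w' x \<partial>lebesgue_on {0<..<L}) = (\<integral>x. a x * u x * w x \<partial>lebesgue_on {0<..<L})"
    if w: "H1_deriv 0 L w w'" for w w'
  proof -
    obtain W where W: "prim 0 L W w'" and N: "negligible {x\<in>{0..L}. w x \<noteq> W x}"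
      using H1_deriv_imp_prim[OF assms(1) w] by metis
    have i1: "(\<lambda>x. v x * w' x) absolutely_integrable_on {0..L}"
      by (rule absint_continuous_mult(2)[OF prim_absint[OF W] cv])
    have i2: "(\<lambda>x. a x * u x * W x) absolutely_integrable_on {0..L}"
      by (rule absint_continuous_mult(1)[OF absint_continuous_mult(1)[OF a_absint cu] prim_continuous[OF W]])
    have i3: "(\<lambda>x. a x * u x * w x) absolutely_integrable_on {0..L}"
      by (rule absolutely_integrable_spike[OF i2 N]) auto
    have "v 0 = 0" "v L = 0" using assms(2) by (auto simp: v_def)
    then have "integral {0..L} (\<lambda>x. - (a x * u x) * W x + v x * w' x) = 0"
      using primD(2)[OF prim_mult[OF u_v_prim(2) W] order_refl _ order_refl] assms(1) by simp
    then have "integral {0..L} (\<lambda>x. v x * w' x - a x * u x * W x) = 0"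
      by (simp add: algebra_simps)
    then have "integral {0..L} (\<lambda>x. v x * w' x) = integral {0..L} (\<lambda>x. a x * u x * W x)"
      using i1 i2 by (subst (asm) Henstock_Kurzweil_Integration.integral_diff) (auto simp: absolutely_integrable_on_def)
    also have "\<dots> = integral {0..L} (\<lambda>x. a x * u x * w x)"
      by (rule integral_spike[OF N]) auto
    finally show ?thesis
      by (simp add: lebesgue_on_Ioo_integral[OF i1] lebesgue_on_Ioo_integral[OF i3])
  qed
  with H show ?thesis unfolding neumann_sol_def by blast
qed

lemma u_nontrivial:
  assumes "L > 0"
  shows "\<not> trivial_fun L u"
proof
  assume "trivial_fun L u"
  then have N: "negligible {x\<in>{0..L}. u x \<noteq> 0}"
    using negligible_iff_AE_Ioo[of 0 L "\<lambda>x. u x = 0"] by (simp add: trivial_fun_def)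
  have c: "continuous_on {0..L} (\<lambda>x. (u x)\<^sup>2)"
    by (intro continuous_intros prim_continuous[OF u_v_prim(1)])
  have "integral {0..L} (\<lambda>x. (u x)\<^sup>2) = integral {0..L} (\<lambda>x. 0)"
    by (rule integral_spike[OF N]) auto
  then have "(u 0)\<^sup>2 = 0"
    using integral_eq_0_iff[OF c] assms by simp
  moreover have "u 0 > 0"
  proof -
    have "\<omega> * r < pi/2" using small(1) \<omega> \<eta> by (simp add: r_def algebra_simps) (smt (verit) mult_pos_pos)
    then have "sin (\<omega> * r) > 0" "cos (\<omega> * r) > 0" "sin (\<mu> * \<eta>) > 0" "cos (\<mu> * \<eta>) > 0"
      using small(2) pi_gt_zero mult_pos_pos[OF \<omega> r] mult_pos_pos[OF \<mu>0 \<eta>(1)]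
      by (intro sin_gt_zero cos_gt_zero; linarith)+
    then have "sin (\<omega> * r) * cos (\<mu> * \<eta>) + \<omega> / \<mu> * cos (\<omega> * r) * sin (\<mu> * \<eta>) > 0"
      using \<omega> \<mu>0 by (intro add_pos_pos mult_pos_pos divide_pos_pos) auto
    moreover have "u 0 = glue (- r) (- l0)"
      using pos_start[of 0] \<eta> r by (simp add: u_def wave_def clamp_def r_def)
    moreover have "- l0 - - r = - \<eta>" by (simp add: r_def)
    ultimately show ?thesis by (simp add: glue_def)
  qed
  ultimately show False by simp
qed

text \<open>The excess lives within \<eta> of the points 2 l0 k for k from 0 to n + 1. The n
  interior points account for width 2 \<eta> each, the two ends for \<eta> each.\<close>

lemma excess_norm_le:
  assumes L: "L = 2 * l0 * (real n + 1)"
  shows "integral {0..L} (\<lambda>x. a x - \<omega>\<^sup>2) \<le> (2 * real n + 2) * ((\<mu>\<^sup>2 - \<omega>\<^sup>2) * \<eta>)"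
proof -
  define D where "D = \<mu>\<^sup>2 - \<omega>\<^sup>2"
  have D: "D \<ge> 0" using \<omega> \<mu> by (simp add: D_def power_mono)
  have l0: "l0 > 0" using \<eta> by simp
  define I where "I k = {max 0 (2 * l0 * real k - \<eta>)..min L (2 * l0 * real k + \<eta>)}" for k :: nat
  define h where "h k x = (if x \<in> I k then D else 0)" for k x
  have IL: "I k \<subseteq> {0..L}" for k by (auto simp: I_def)
  define w where "w k = (if k = 0 then \<eta> else 2 * \<eta>) - (if k = Suc n then \<eta> else 0)" for k
  have ne: "max 0 (2 * l0 * real k - \<eta>) \<le> min L (2 * l0 * real k + \<eta>)"
    and len: "min L (2 * l0 * real k + \<eta>) - max 0 (2 * l0 * real k - \<eta>) \<le> w k" if "k \<le> Suc n" for k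
  proof -
    have "real k \<le> real n + 1" using that by linarith
    then have "2 * l0 * real k \<le> L" unfolding L using l0 by (intro mult_left_mono) auto
    moreover have "0 \<le> 2 * l0 * real k" using l0 by simp
    ultimately show "max 0 (2 * l0 * real k - \<eta>) \<le> min L (2 * l0 * real k + \<eta>)"
      using \<eta> by linarith
    show "min L (2 * l0 * real k + \<eta>) - max 0 (2 * l0 * real k - \<eta>) \<le> w k"
      using \<eta> by (auto simp: w_def L algebra_simps)
  qed
  have hI: "(h k has_integral D * (min L (2 * l0 * real k + \<eta>) - max 0 (2 * l0 * real k - \<eta>))) {0..L}"
    if "k \<le> Suc n" for k
  proof -
    have "((\<lambda>x. D) has_integral D * (t - s)) {s..t}" if "s \<le> t" for s t :: real
      using has_integral_const_real[of D s t] that by (simp add: mult.commute)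
    from this[OF ne[OF that]]
    have "((\<lambda>x. D) has_integral D * (min L (2 * l0 * real k + \<eta>) - max 0 (2 * l0 * real k - \<eta>))) (I k)"
      unfolding I_def .
    then show ?thesis unfolding h_def by (simp only: has_integral_restrict[OF IL])
  qed
  have "integral {0..L} (\<lambda>x. a x - \<omega>\<^sup>2) \<le> integral {0..L} (\<lambda>x. \<Sum>k\<le>Suc n. h k x)"
  proof (rule integral_le)
    show "(\<lambda>x. a x - \<omega>\<^sup>2) integrable_on {0..L}"
      using a_absint by (intro integrable_diff) (auto simp: absolutely_integrable_on_def)
    show "(\<lambda>x. \<Sum>k\<le>Suc n. h k x) integrable_on {0..L}"
      using hI by (intro integrable_sum) (auto simp: has_integral_integrable)
    fix x assume x: "x \<in> {0..L}"
    show "a x - \<omega>\<^sup>2 \<le> (\<Sum>k\<le>Suc n. h k x)"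
    proof (cases "\<bar>pos x\<bar> < r")
      case True
      moreover have "0 \<le> (\<Sum>k\<le>Suc n. h k x)" using D by (intro sum_nonneg) (simp add: h_def)
      ultimately show ?thesis by (simp add: a_def pot_def)
    next
      case False
      obtain k :: int where k: "\<bar>x - 2 * l0 * of_int k\<bar> \<le> l0" "\<bar>pos x\<bar> = l0 - \<bar>x - 2 * l0 * of_int k\<bar>"
        by (rule pos_nearest_extremum)
      have xk: "\<bar>x - 2 * l0 * of_int k\<bar> \<le> \<eta>" using False k(2) by (simp add: r_def)
      \<comment> \<open>As \<eta> < l0, the nearest extremum to a point of [0,L] with excess cannot
        have number - 1 or n + 2.\<close>
      have "2 * l0 * of_int k > 2 * l0 * (-1)" using xk \<eta> x by auto
      then have "- 1 < real_of_int k" using l0 by (subst (asm) mult_less_cancel_left_pos) auto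
      then have k0: "k \<ge> 0" by linarith
      have "2 * l0 * of_int k < 2 * l0 * (real n + 2)" using xk \<eta> x by (auto simp: L algebra_simps)
      then have "of_int k < real n + 2" using l0 by (subst (asm) mult_less_cancel_left_pos) auto
      then have kn: "nat k \<le> Suc n" using k0 by linarith
      have "x \<in> I (nat k)" using xk k0 x by (auto simp: I_def)
      then have "a x - \<omega>\<^sup>2 = h (nat k) x" using False by (simp add: h_def a_def pot_def D_def)
      also have "\<dots> \<le> (\<Sum>k\<le>Suc n. h k x)"
        using kn D by (intro member_le_sum) (auto simp: h_def)
      finally show ?thesis .
    qed
  qed
  also have "\<dots> = (\<Sum>k\<le>Suc n. D * (min L (2 * l0 * real k + \<eta>) - max 0 (2 * l0 * real k - \<eta>)))"
    using hI by (intro integral_unique has_integral_sum) auto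
  also have "\<dots> \<le> (\<Sum>k\<le>Suc n. D * w k)"
    using D len by (intro sum_mono mult_left_mono) auto
  also have "\<dots> = D * (\<Sum>k\<le>Suc n. w k)" by (simp only: sum_distrib_left)
  also have "(\<Sum>k\<le>Suc n. w k) = (2 * real n + 2) * \<eta>"
  proof -
    have "(\<Sum>k\<le>Suc n. w k) = w 0 + (\<Sum>k\<in>{1..n}. 2 * \<eta>) + w (Suc n)"
    proof -
      have "(\<Sum>k\<le>n. w k) = w 0 + (\<Sum>k\<in>{1..n}. w k)"
        by (simp add: sum.atMost_shift sum.atLeast1_atMost_eq)
      moreover have "(\<Sum>k\<in>{1..n}. w k) = (\<Sum>k\<in>{1..n}. 2 * \<eta>)"
        by (intro sum.cong) (auto simp: w_def)
      ultimately show ?thesis by simp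
    qed
    then show ?thesis by (simp add: w_def algebra_simps)
  qed
  finally show ?thesis by (simp add: D_def algebra_simps)
qed

lemma a_in_Lambda_set:
  assumes "n \<ge> 1" and L: "L = 2 * l0 * (real n + 1)" and lam: "lam L n = \<omega>\<^sup>2"
  shows "a \<in> Lambda_set L n"
    and "L1_norm 0 L (\<lambda>x. a x - lam L n) \<le> (2 * real n + 2) * ((\<mu>\<^sup>2 - \<omega>\<^sup>2) * \<eta>)"
proof -
  have l0: "l0 > 0" using \<eta> by simp
  have L0: "L > 0" unfolding L using l0 by simp
  have "\<kappa> * L = of_int (int n + 1) * pi" using l0 by (simp add: L \<kappa>_def field_simps)
  then have s: "sin (\<kappa> * L) = 0" unfolding sin_zero_iff_int2 by blast
  have ai: "(\<lambda>x. a x - lam L n) absolutely_integrable_on {0..L}"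
    by (rule set_integral_diff(1)[OF a_absint continuous_imp_absint[OF continuous_on_const]])
  have "prec L (\<lambda>_. lam L n) a"
    unfolding prec_def lam
  proof
    show "AE x in lebesgue_on {0..L}. \<omega>\<^sup>2 \<le> a x" using a_ge by simp
    have "pos \<in> borel_measurable borel" by (rule borel_measurable_continuous_onI[OF cont(1)])
    then have "a \<in> borel_measurable borel" unfolding a_def[abs_def] pot_def by measurable
    then have "{x \<in> space borel. 0 \<le> x \<and> x \<le> L \<and> \<omega>\<^sup>2 < a x} \<in> sets borel" by measurable
    then have "{x \<in> {0..L}. \<omega>\<^sup>2 < a x} \<in> sets lebesgue" by simp
    moreover have "{0..\<eta>} \<subseteq> {x \<in> {0..L}. \<omega>\<^sup>2 < a x}"
    proof -
      have "\<omega>\<^sup>2 < \<mu>\<^sup>2" using \<omega> \<mu> by (intro power_strict_mono) auto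
      moreover have "l0 \<le> L" unfolding L using l0 by (simp add: algebra_simps)
      moreover have "\<not> \<bar>pos x\<bar> < r" if "0 \<le> x" "x \<le> \<eta>" for x
        using pos_start[of x] that \<eta> by (simp add: r_def)
      ultimately show ?thesis using \<eta> by (auto simp: a_def pot_def)
    qed
    ultimately have "emeasure lebesgue {0..\<eta>} \<le> emeasure lebesgue {x \<in> {0..L}. \<omega>\<^sup>2 < a x}"
      by (intro emeasure_mono) auto
    moreover have "emeasure lebesgue {0..\<eta>} > 0" using \<eta> by simp
    ultimately show "0 < emeasure lebesgue {x \<in> {0..L}. \<omega>\<^sup>2 < a x}" by (rule less_le_trans[rotated])
  qed
  then show "a \<in> Lambda_set L n"
    unfolding Lambda_set_def L1_fun_iff
    using a_absint neumann_sol_u[OF L0 s] u_nontrivial[OF L0] by blast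
  have "L1_norm 0 L (\<lambda>x. a x - lam L n) = integral {0..L} (\<lambda>x. a x - \<omega>\<^sup>2)"
    using L1_norm_eq[OF ai] a_ge by (simp add: lam)
  then show "L1_norm 0 L (\<lambda>x. a x - lam L n) \<le> (2 * real n + 2) * ((\<mu>\<^sup>2 - \<omega>\<^sup>2) * \<eta>)"
    using excess_norm_le[OF L] by simp
qed

end

section \<open>Choice of the inner frequency and the limit of vanishing width\<close>

lemma arctan_le_self:
  fixes x :: real
  assumes "x \<ge> 0"
  shows "arctan x \<le> x"
proof -
  have "0 - arctan 0 \<le> x - arctan x"
  proof (rule DERIV_nonneg_imp_nondecreasing[OF assms])
    fix t :: real
    have "((\<lambda>t. t - arctan t) has_real_derivative 1 - inverse (1 + t\<^sup>2)) (at t)"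
      by (auto intro!: derivative_eq_intros)
    moreover have "1 - inverse (1 + t\<^sup>2) \<ge> 0" by (simp add: field_simps add_pos_nonneg)
    ultimately show "\<exists>y. ((\<lambda>t. t - arctan t) has_real_derivative y) (at t) \<and> 0 \<le> y" by blast
  qed
  then show ?thesis by simp
qed

text \<open>Dividing \<open>match\<close> by a sine and a cosine gives \<open>\<mu> tan (\<mu>
  \<eta>) = \<omega> cot (\<omega> (l0 - \<eta>))\<close>, solved by the intermediate value theorem.
  Since \<open>\<mu> \<eta> \<le> tan (\<mu> \<eta>)\<close>, the same equation bounds
  \<open>\<mu>\<^sup>2 \<eta>\<close>.\<close>

lemma quarter_wave_exists:
  fixes \<omega> l0 \<eta> :: real
  assumes \<omega>: "\<omega> > 0" "\<omega> * l0 < pi/2" and \<eta>: "0 < \<eta>" "\<eta> < l0"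
  obtains \<mu> where "quarter_wave \<omega> l0 \<eta> \<mu>" "(\<mu>\<^sup>2 - \<omega>\<^sup>2) * \<eta> \<le> \<omega> * cot (\<omega> * (l0 - \<eta>))"
proof -
  define y where "y = \<omega> * (l0 - \<eta>)"
  have p: "\<omega> * \<eta> > 0" using \<omega> \<eta> by simp
  have y: "0 < y" "y < pi/2 - \<omega> * \<eta>" using \<omega> \<eta> by (auto simp: y_def algebra_simps)
  then have y2: "y < pi/2" using p by linarith
  have sc: "sin y > 0" "cos y > 0" using y y2 pi_gt_zero by (auto intro!: sin_gt_zero cos_gt_zero)
  have cot: "cot y > 0" using cot_pos[OF y(1) y2] .
  \<comment> \<open>T is pi/2 - y and exceeds \<open>\<omega> * \<eta>\<close> because
    \<open>\<omega> * l0 < pi/2\<close>. Hence h is below the target at \<omega>, and at T / \<eta>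
    it is T / \<eta> times cot y, which is above.\<close>
  define T where "T = arctan (cot y)"
  have T: "0 < T" "T < pi/2" "tan T = cot y" using cot arctan_ubound[of "cot y"] by (auto simp: T_def tan_arctan zero_less_arctan_iff)
  have "sin (pi/2 - y) = cos y" "cos (pi/2 - y) = sin y"
    by (simp_all add: cos_sin_eq[of y] sin_cos_eq[of y])
  then have "tan (pi/2 - y) = cot y" by (simp add: tan_def cot_def)
  then have "T = pi/2 - y"
    unfolding T_def using y y2 by (intro arctan_unique) auto
  then have T\<omega>: "\<omega> * \<eta> < T" using y by simp
  define h where "h m = m * tan (m * \<eta>)" for m
  have h: "continuous_on {\<omega>..T / \<eta>} h"
    unfolding h_def
  proof (intro continuous_intros ballI)
    fix m assume "m \<in> {\<omega>..T / \<eta>}"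
    then have "0 < m * \<eta>" "m * \<eta> \<le> T" using \<omega> \<eta> by (auto simp: field_simps)
    then show "cos (m * \<eta>) \<noteq> 0" using T by (intro less_imp_neq[symmetric] cos_gt_zero) auto
  qed
  have le: "\<omega> \<le> T / \<eta>" "\<omega> < T / \<eta>" using T\<omega> \<eta> by (auto simp: field_simps)
  have h1: "h \<omega> < \<omega> * cot y"
    unfolding h_def T(3)[symmetric] using \<omega> T T\<omega> p by (intro mult_strict_left_mono tan_monotone) auto
  have "\<omega> * cot y \<le> T / \<eta> * cot y" using le cot by (intro mult_right_mono) auto
  then have h2: "\<omega> * cot y \<le> h (T / \<eta>)" unfolding h_def using T(3) \<eta> by simp
  obtain \<mu> where \<mu>: "\<omega> \<le> \<mu>" "\<mu> \<le> T / \<eta>" "h \<mu> = \<omega> * cot y"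
    using IVT'[of h \<omega> "\<omega> * cot y" "T / \<eta>"] h1 h2 le(1) h by auto
  have \<mu>\<omega>: "\<omega> < \<mu>" using \<mu> h1 by (cases "\<mu> = \<omega>") auto
  have \<mu>\<eta>: "0 < \<mu> * \<eta>" "\<mu> * \<eta> < pi/2" using \<mu>(2) \<mu>\<omega> \<omega> \<eta> T by (auto simp: field_simps)
  have cm: "cos (\<mu> * \<eta>) > 0" using \<mu>\<eta> by (intro cos_gt_zero) auto
  have Q: "quarter_wave \<omega> l0 \<eta> \<mu>"
  proof
    have "\<mu> * tan (\<mu> * \<eta>) = \<omega> * cot y" using \<mu>(3) by (simp add: h_def)
    then show "\<omega> * cos (\<omega> * (l0 - \<eta>)) * cos (\<mu> * \<eta>) = \<mu> * sin (\<omega> * (l0 - \<eta>)) * sin (\<mu> * \<eta>)"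
      using sc cm unfolding y_def[symmetric] tan_def cot_def by (simp add: field_simps)
  qed (use \<omega> \<eta> \<mu>\<omega> \<mu>\<eta> in auto)
  have "\<mu> * \<eta> \<le> tan (\<mu> * \<eta>)"
    using arctan_le_self[of "tan (\<mu> * \<eta>)"] arctan_tan[of "\<mu> * \<eta>"] \<mu>\<eta> tan_gt_zero[of "\<mu> * \<eta>"] by simp
  then have "\<mu> * (\<mu> * \<eta>) \<le> \<mu> * tan (\<mu> * \<eta>)" using \<mu>\<omega> \<omega> by simp
  moreover have "(\<mu>\<^sup>2 - \<omega>\<^sup>2) * \<eta> \<le> \<mu> * (\<mu> * \<eta>)" using \<eta> by (simp add: power2_eq_square algebra_simps)
  ultimately have "(\<mu>\<^sup>2 - \<omega>\<^sup>2) * \<eta> \<le> \<omega> * cot (\<omega> * (l0 - \<eta>))"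
    using \<mu>(3) by (simp add: h_def y_def)
  with Q show ?thesis using that by blast
qed

text \<open>Each width \<eta> yields a member of \<open>Lambda_set\<close> and thus an upper bound;
  these bounds tend to the stated one as \<eta> decreases to 0, the cotangent being continuous at
  \<open>\<omega>\<close> times the cell length.\<close>

lemma beta1_le:
  assumes L: "L > 0" and n: "n \<ge> 1"
  shows "beta1 L n \<le> (2 * real n + 2) * (freq L n * cot (freq L n * cell L n))"
proof -
  note F = freq_cell[OF L n]
  let ?\<omega> = "freq L n" and ?l = "cell L n"
  have bdd: "bdd_below ((\<lambda>a. L1_norm 0 L (\<lambda>x. a x - lam L n)) ` Lambda_set L n)"
    by (rule bdd_belowI2[of _ 0]) (simp add: L1_norm_def)
  have le: "beta1 L n \<le> (2 * real n + 2) * (?\<omega> * cot (?\<omega> * (?l - \<eta>)))" if \<eta>: "0 < \<eta>" "\<eta> < ?l" for \<eta>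
  proof -
    obtain \<mu> where Q: "quarter_wave ?\<omega> ?l \<eta> \<mu>" and le: "(\<mu>\<^sup>2 - ?\<omega>\<^sup>2) * \<eta> \<le> ?\<omega> * cot (?\<omega> * (?l - \<eta>))"
      using quarter_wave_exists[OF F(1,3) \<eta>] by blast
    have "L = 2 * ?l * (real n + 1)" using F(7) by (simp add: algebra_simps)
    note A = quarter_wave.a_in_Lambda_set[OF Q n this F(5)]
    have "beta1 L n \<le> L1_norm 0 L (\<lambda>x. quarter_wave.a ?\<omega> ?l \<eta> \<mu> x - lam L n)"
      unfolding beta1_def by (rule cINF_lower[OF bdd A(1)])
    also note A(2)
    also have "(2 * real n + 2) * ((\<mu>\<^sup>2 - ?\<omega>\<^sup>2) * \<eta>) \<le> (2 * real n + 2) * (?\<omega> * cot (?\<omega> * (?l - \<eta>)))"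
      using le by (intro mult_left_mono) auto
    finally show ?thesis .
  qed
  have "sin (?\<omega> * ?l) \<noteq> 0"
    using F(3,4) pi_gt_zero by (intro less_imp_neq[symmetric] sin_gt_zero) linarith+
  then have "((\<lambda>\<eta>. (2 * real n + 2) * (?\<omega> * cot (?\<omega> * (?l - \<eta>)))) \<longlongrightarrow> (2 * real n + 2) * (?\<omega> * cot (?\<omega> * (?l - 0)))) (at_right 0)"
    by (intro tendsto_intros) auto
  moreover have "eventually (\<lambda>\<eta>. beta1 L n \<le> (2 * real n + 2) * (?\<omega> * cot (?\<omega> * (?l - \<eta>)))) (at_right 0)"
    using eventually_at_right_real[OF F(2)] by eventually_elim (auto intro: le)
  ultimately have "beta1 L n \<le> (2 * real n + 2) * (?\<omega> * cot (?\<omega> * (?l - 0)))"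
    by (intro tendsto_lowerbound[where F = "at_right 0"]) auto
  then show ?thesis by simp
qed

theorem theorem3p2:
  fixes L :: real and n :: nat
  assumes "L > 0" and "n \<ge> 1"
  shows
    "(\<forall>a. L1_fun 0 L a \<and> prec L (\<lambda>_. lam L n) a \<and> cond_B L n a \<longrightarrow>
        (\<forall>u. neumann_sol L a u \<longleftrightarrow> trivial_fun L u))
   \<and> (\<forall>a. L1_fun 0 L a \<and> prec L (\<lambda>_. lam L n) a \<and> cond_A L n a \<longrightarrow> cond_B L n a)
   \<and> (\<forall>y. partition_points L n y \<and>
          (\<forall>k\<le>2*n+1. y (k+1) - y k < L / (2 * real n)) \<and>
          (\<exists>i\<le>2*n+1. \<exists>j\<le>2*n+1. y (i+1) - y i \<noteq> y (j+1) - y j) \<longrightarrow>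
        (\<exists>a. L1_fun 0 L a \<and> prec L (\<lambda>_. lam L n) a \<and>
             cond_B L n a \<and> cond_B_at L n y a \<and> \<not> cond_A L n a))"
proof (intro conjI allI impI; (elim conjE)?)
  fix a u
  assume a: "L1_fun 0 L a" "prec L (\<lambda>_. lam L n) a" and B: "cond_B L n a"
  interpret neumann_potential L n a "\<lambda>x. \<bar>a x - lam L n\<bar>"
    by unfold_locales (use assms a in auto)
  show "neumann_sol L a u \<longleftrightarrow> trivial_fun L u"
    using B solution_trivial trivial_imp_neumann_sol unfolding cond_B_def by blast
next
  fix a
  assume a: "L1_fun 0 L a" "prec L (\<lambda>_. lam L n) a" and A: "cond_A L n a"
  interpret neumann_potential L n a "\<lambda>x. \<bar>a x - lam L n\<bar>"
    by unfold_locales (use assms a in auto)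
  have "integral {0..L} (\<lambda>x. \<bar>a x - lam L n\<bar>) < beta1 L n"
    using A L1_norm_b[of 0 L] by (simp add: cond_A_def)
  then show "cond_B L n a"
    using beta1_le[OF assms] by (intro cond_B_if_norm_less) linarith
next
  fix y
  assume y: "partition_points L n y" "\<forall>k\<le>2*n+1. y (k+1) - y k < L / (2 * real n)"
    and "\<exists>i\<le>2*n+1. \<exists>j\<le>2*n+1. y (i+1) - y i \<noteq> y (j+1) - y j"
  then obtain i j where ij: "i \<le> 2*n+1" "j \<le> 2*n+1" "y (i+1) - y i \<noteq> y (j+1) - y j" by blast
  obtain a where a: "L1_fun 0 L a" "prec L (\<lambda>_. lam L n) a" "cond_B_at L n y a"
    "L1_norm 0 L (\<lambda>x. a x - lam L n) = (2 * real n + 2) * (freq L n * cot (freq L n * cell L n))"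
    using unequal_partition_witness[OF assms y(1) _ ij] y(2) by blast
  have "\<not> cond_A L n a" using a(4) beta1_le[OF assms] by (simp add: cond_A_def)
  then show "\<exists>a. L1_fun 0 L a \<and> prec L (\<lambda>_. lam L n) a \<and> cond_B L n a \<and> cond_B_at L n y a \<and> \<not> cond_A L n a"
    using a y(1) unfolding cond_B_def by blast
qed

end
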